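(* Let $K$ be a field of characteristic zero, $n\ge1$, and let $M$ be a generalized weight left $\mathbb I_n$-module. The $\mathbb I_n$-module $M$ is finitely generated if and only if its support is a subset of a union of finitely many orbits in $K^n/\mathbb Z^n$ and the dimensions of all generalized weight components of $M$ are bounded by a natural number.
   Context: $P_n=K[x_1,\dots,x_n]$. $\mathbb I_n$ is the $K$-subalgebra of $\mathrm{End}_K(P_n)$ generated by the multiplications by $x_i$, the partial derivatives $\partial_i$, and the integrations $\int_i$ ($K$-linear, $x^\alpha\mapsto x_ix^\alpha/(\alpha_i+1)$), $i=1,\dots,n$. $H_i=\partial_ix_i$ and $D_n=K[H_1,\dots,H_n]\subset\mathbb I_n$ is a polynomial algebra. For $\lambda\in K^n$, $\mathfrak m_\lambda=(H_1-\lambda_1,\dots,H_n-\lambda_n)\subset D_n$. For an $\mathbb I_n$-module $M$, the generalized weight components are $M^\lambda=\{v\in M:\mathfrak m_\lambda^iv=0\text{ for some }i\ge0\}$; $M$ is a generalized weight module if $M=\bigoplus_{\lambda\in K^n}M^\lambda$, and $\mathrm{Supp}(M)=\{\lambda\in K^n:M^\lambda\neq0\}$. Orbits are those of the translation action of $\mathbb Z^n$ on $K^n$. Dimensions are over $K$. *)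

theory Defs
  imports Complex_Main "HOL-Library.Poly_Mapping"
begin

section \<open>Polynomials and their operators\<close>

text \<open>
  \<open>K[x\<^sub>i | i \<in> 'n]\<close> is the monoid algebra of the exponent vectors \<open>'n \<Rightarrow>\<^sub>0 nat\<close>; for \<open>n\<close> variables
  take \<open>'n\<close> to be a finite type with \<open>n\<close> elements (so \<open>n \<ge> 1\<close>, as types are nonempty).
\<close>

type_synonym ('k, 'n) mpoly = "('n \<Rightarrow>\<^sub>0 nat) \<Rightarrow>\<^sub>0 'k"

type_synonym ('k, 'n) mpoly_op = "('k, 'n) mpoly \<Rightarrow> ('k, 'n) mpoly"

definition scalar :: "'k::field_char_0 \<Rightarrow> ('k, 'n) mpoly_op" where
  "scalar c p = Poly_Mapping.single 0 c * p"

definition linear_ext :: "(('n \<Rightarrow>\<^sub>0 nat) \<Rightarrow> ('k, 'n) mpoly) \<Rightarrow> ('k::field_char_0, 'n) mpoly_op" where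
  "linear_ext g p = (\<Sum>\<alpha>\<in>Poly_Mapping.keys p. scalar (Poly_Mapping.lookup p \<alpha>) (g \<alpha>))"

definition mult_var :: "'n \<Rightarrow> ('k::field_char_0, 'n) mpoly_op" where
  "mult_var i p = Poly_Mapping.single (Poly_Mapping.single i 1) 1 * p"

text \<open>The subtraction of exponents truncates only where the coefficient vanishes.\<close>

definition partial :: "'n \<Rightarrow> ('k::field_char_0, 'n) mpoly_op" where
  "partial i = linear_ext (\<lambda>\<alpha>.
     Poly_Mapping.single (\<alpha> - Poly_Mapping.single i 1) (of_nat (Poly_Mapping.lookup \<alpha> i)))"

definition integration :: "'n \<Rightarrow> ('k::field_char_0, 'n) mpoly_op" where
  "integration i = linear_ext (\<lambda>\<alpha>.
     Poly_Mapping.single (\<alpha> + Poly_Mapping.single i 1)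
       (1 / of_nat (Poly_Mapping.lookup \<alpha> i + 1)))"

lemma linear_ext_single [simp]: "linear_ext g (Poly_Mapping.single \<alpha> c) = scalar c (g \<alpha>)"
  by (simp add: linear_ext_def scalar_def)

lemma linear_ext_add: "linear_ext g (p + q) = linear_ext g p + linear_ext g q"
proof -
  let ?A = "Poly_Mapping.keys p \<union> Poly_Mapping.keys q"
  have *: "linear_ext g r = (\<Sum>\<alpha>\<in>?A. scalar (Poly_Mapping.lookup r \<alpha>) (g \<alpha>))"
    if "Poly_Mapping.keys r \<subseteq> ?A" for r
    unfolding linear_ext_def
    by (rule sum.mono_neutral_left) (use that in \<open>auto simp: in_keys_iff scalar_def\<close>)
  have "linear_ext g (p + q) = (\<Sum>\<alpha>\<in>?A. scalar (Poly_Mapping.lookup (p + q) \<alpha>) (g \<alpha>))"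
    by (rule *) (rule Poly_Mapping.keys_add)
  also have "\<dots> = linear_ext g p + linear_ext g q"
    by (simp add: * lookup_add scalar_def single_add distrib_right sum.distrib)
  finally show ?thesis .
qed

lemma scalar_scalar: "scalar a (scalar b p) = scalar (a * b) p"
  by (simp add: scalar_def mult_single flip: mult.assoc)

lemma linear_ext_scalar: "linear_ext g (scalar c p) = scalar c (linear_ext g p)"
proof -
  have l: "Poly_Mapping.lookup (scalar c p) \<alpha> = c * Poly_Mapping.lookup p \<alpha>" for \<alpha>
    by (simp add: scalar_def map.rep_eq when_def flip: mult_map_scale_conv_mult)
  have "linear_ext g (scalar c p) =
      (\<Sum>\<alpha>\<in>Poly_Mapping.keys p. scalar (Poly_Mapping.lookup (scalar c p) \<alpha>) (g \<alpha>))"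
    unfolding linear_ext_def
    by (rule sum.mono_neutral_left) (auto simp: in_keys_iff scalar_def l[unfolded scalar_def])
  also have "\<dots> = scalar c (linear_ext g p)"
    by (simp add: linear_ext_def l flip: scalar_scalar) (simp add: scalar_def sum_distrib_left)
  finally show ?thesis .
qed


section \<open>The algebra of integro-differential operators\<close>

inductive_set generated_subalgebra :: "('k::field_char_0, 'n) mpoly_op set \<Rightarrow> ('k, 'n) mpoly_op set"
  for S where
  gen: "f \<in> S \<Longrightarrow> f \<in> generated_subalgebra S"
| one: "id \<in> generated_subalgebra S"
| scale: "f \<in> generated_subalgebra S \<Longrightarrow> scalar c \<circ> f \<in> generated_subalgebra S"
| add: "f \<in> generated_subalgebra S \<Longrightarrow> g \<in> generated_subalgebra S \<Longrightarrow>
    (\<lambda>p. f p + g p) \<in> generated_subalgebra S"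
| comp: "f \<in> generated_subalgebra S \<Longrightarrow> g \<in> generated_subalgebra S \<Longrightarrow>
    f \<circ> g \<in> generated_subalgebra S"

definition integro_diff_algebra :: "('k::field_char_0, 'n) mpoly_op set" where
  "integro_diff_algebra =
     generated_subalgebra (range mult_var \<union> range partial \<union> range integration)"

definition H_op :: "'n \<Rightarrow> ('k::field_char_0, 'n) mpoly_op" where
  "H_op i = partial i \<circ> mult_var i"

definition D_algebra :: "('k::field_char_0, 'n) mpoly_op set" where
  "D_algebra = generated_subalgebra (range H_op)"

inductive_set generated_ideal ::
    "('k::field_char_0, 'n) mpoly_op set \<Rightarrow> ('k, 'n) mpoly_op set \<Rightarrow> ('k, 'n) mpoly_op set"
  for A S where
  zero: "(\<lambda>p. 0) \<in> generated_ideal A S"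
| gen: "s \<in> S \<Longrightarrow> a \<in> A \<Longrightarrow> b \<in> A \<Longrightarrow> a \<circ> s \<circ> b \<in> generated_ideal A S"
| add: "f \<in> generated_ideal A S \<Longrightarrow> g \<in> generated_ideal A S \<Longrightarrow>
    (\<lambda>p. f p + g p) \<in> generated_ideal A S"

primrec ideal_power ::
    "('k::field_char_0, 'n) mpoly_op set \<Rightarrow> ('k, 'n) mpoly_op set \<Rightarrow> nat \<Rightarrow> ('k, 'n) mpoly_op set" where
  "ideal_power A I 0 = A"
| "ideal_power A I (Suc k) = generated_ideal A {a \<circ> b |a b. a \<in> I \<and> b \<in> ideal_power A I k}"

definition max_ideal :: "('n \<Rightarrow> 'k::field_char_0) \<Rightarrow> ('k, 'n) mpoly_op set" where
  "max_ideal \<mu> = generated_ideal D_algebra (range (\<lambda>i p. H_op i p - scalar (\<mu> i) p))"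


section \<open>Modules\<close>

text \<open>
  A left module over an algebra \<open>A\<close> of operators. The values of the action outside \<open>A\<close> are
  irrelevant.
\<close>

locale left_module =
  fixes A :: "('k::field_char_0, 'n) mpoly_op set"
    and act :: "('k, 'n) mpoly_op \<Rightarrow> 'm::ab_group_add \<Rightarrow> 'm"
  assumes act_add_right: "a \<in> A \<Longrightarrow> act a (v + w) = act a v + act a w"
    and act_add_left: "a \<in> A \<Longrightarrow> b \<in> A \<Longrightarrow> act (\<lambda>p. a p + b p) v = act a v + act b v"
    and act_comp: "a \<in> A \<Longrightarrow> b \<in> A \<Longrightarrow> act (a \<circ> b) v = act a (act b v)"
    and act_id: "act id v = v"

text \<open>The \<open>K\<close>-vector space structure of a module comes from the embedding \<open>K \<rightarrow> A\<close>.\<close>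

definition module_scale :: "(('k::field_char_0, 'n) mpoly_op \<Rightarrow> 'm \<Rightarrow> 'm) \<Rightarrow> 'k \<Rightarrow> 'm \<Rightarrow> 'm" where
  "module_scale act c v = act (scalar c) v"

lemma scalar_in_generated_subalgebra: "scalar c \<in> generated_subalgebra S"
  using generated_subalgebra.scale[OF generated_subalgebra.one, of c S] by simp

lemma vector_space_module_scale:
  fixes act :: "('k::field_char_0, 'n) mpoly_op \<Rightarrow> 'm::ab_group_add \<Rightarrow> 'm"
  assumes "left_module (generated_subalgebra S) act"
  shows "vector_space (module_scale act)"
proof -
  interpret left_module "generated_subalgebra S" act by fact
  note s = scalar_in_generated_subalgebra
  show ?thesis
  proof
    fix a b :: 'k and v w :: 'm
    show "module_scale act a (v + w) = module_scale act a v + module_scale act a w"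
      by (simp add: module_scale_def act_add_right s)
    have "scalar (a + b) = (\<lambda>p :: ('k, 'n) mpoly. scalar a p + scalar b p)"
      by (simp add: fun_eq_iff scalar_def single_add distrib_right)
    thus "module_scale act (a + b) v = module_scale act a v + module_scale act b v"
      by (simp add: module_scale_def act_add_left s)
    have "scalar (a * b) = (scalar a \<circ> scalar b :: ('k, 'n) mpoly_op)"
      by (simp add: fun_eq_iff scalar_scalar)
    thus "module_scale act a (module_scale act b v) = module_scale act (a * b) v"
      by (simp add: module_scale_def act_comp s)
    have "scalar 1 = (id :: ('k, 'n) mpoly_op)"
      by (simp add: fun_eq_iff scalar_def)
    thus "module_scale act 1 v = v"
      by (simp add: module_scale_def act_id)
  qed
qed

definition finitely_generated ::
    "('k::field_char_0, 'n) mpoly_op set \<Rightarrow> (('k, 'n) mpoly_op \<Rightarrow> 'm::ab_group_add \<Rightarrow> 'm) \<Rightarrow> bool" where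
  "finitely_generated A act \<longleftrightarrow>
     (\<exists>S. finite S \<and> (\<forall>v. \<exists>a. (\<forall>s\<in>S. a s \<in> A) \<and> v = (\<Sum>s\<in>S. act (a s) s)))"

definition gen_weight_component ::
    "(('k::field_char_0, 'n) mpoly_op \<Rightarrow> 'm::ab_group_add \<Rightarrow> 'm) \<Rightarrow> ('n \<Rightarrow> 'k) \<Rightarrow> 'm set" where
  "gen_weight_component act \<mu> =
     {v. \<exists>i. \<forall>a\<in>ideal_power D_algebra (max_ideal \<mu>) i. act a v = 0}"

definition direct_sum_decomposition :: "('i \<Rightarrow> 'm::ab_group_add set) \<Rightarrow> bool" where
  "direct_sum_decomposition N \<longleftrightarrow>
     (\<forall>v. \<exists>!f. (\<forall>i. f i \<in> N i) \<and> finite {i. f i \<noteq> 0} \<and> v = (\<Sum>i | f i \<noteq> 0. f i))"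

definition gen_weight_module ::
    "(('k::field_char_0, 'n) mpoly_op \<Rightarrow> 'm::ab_group_add \<Rightarrow> 'm) \<Rightarrow> bool" where
  "gen_weight_module act \<longleftrightarrow>
     left_module integro_diff_algebra act \<and> direct_sum_decomposition (gen_weight_component act)"

definition supp ::
    "(('k::field_char_0, 'n) mpoly_op \<Rightarrow> 'm::ab_group_add \<Rightarrow> 'm) \<Rightarrow> ('n \<Rightarrow> 'k) set" where
  "supp act = {\<mu>. gen_weight_component act \<mu> \<noteq> {0}}"

definition translation_orbit :: "('n \<Rightarrow> 'k::field_char_0) \<Rightarrow> ('n \<Rightarrow> 'k) set" where
  "translation_orbit \<mu> = {\<lambda>i. \<mu> i + of_int (z i) |z :: 'n \<Rightarrow> int. True}"

text \<open>
  As \<^const>\<open>vector_space.dim\<close> is a natural number also on infinite-dimensional subspaces, finite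
  dimensionality is a separate requirement.
\<close>

definition dim_at_most :: "('k::field \<Rightarrow> 'm::ab_group_add \<Rightarrow> 'm) \<Rightarrow> 'm set \<Rightarrow> nat \<Rightarrow> bool" where
  "dim_at_most scl V d \<longleftrightarrow>
     (\<exists>B. finite B \<and> module.span scl B = V) \<and> vector_space.dim scl V \<le> d"

end

theory Submission
  imports Defs
begin

text \<open>
  On the weight component of \<open>\<mu>\<close>, integration and differentiation in the direction \<open>i\<close> are mutually
  inverse isomorphisms, except across the wall between the \<open>i\<close>-th coordinates 0 and 1, where
  \<open>\<partial>\<^sub>i \<circ> \<integral>\<^sub>i = 1\<close> still makes differentiation surjective: the idempotent \<open>1 - \<integral>\<^sub>i \<circ> \<partial>\<^sub>i\<close> is
  fixed by \<open>H\<^sub>i\<close> and so vanishes unless \<open>\<mu>\<^sub>i = 1\<close>. Hence each orbit has a weight \<open>\<kappa>\<close>, namely any one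
  without coordinates in \<open>{0, -1, -2, \<dots>}\<close>, whose component surjects onto every other component of the
  orbit by integrations followed by differentiations. Bases of these components generate the module, and
  their dimensions bound all the others. Conversely, the submodule generated by a weight vector has
  finite-dimensional components, as it is spanned by the vectors \<open>\<integral>\<^sup>a \<partial>\<^sup>b H\<^sup>c v\<close>: the operators
  \<open>H\<^sub>i - \<mu>\<^sub>i\<close> act nilpotently, and for a fixed difference \<open>a - b\<close> only finitely many \<open>b\<close>
  contribute because \<open>\<integral>\<^sub>i \<circ> \<partial>\<^sub>i = 1\<close> away from the wall.
\<close>

section \<open>Relations between the operators\<close>

lemma scalar_add: "scalar c (p + q) = scalar c p + scalar c q"
  by (simp add: scalar_def distrib_left)

lemma scalar_add_left: "scalar (c + d) p = scalar c p + scalar d p"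
  by (simp add: scalar_def single_add distrib_right)

lemma scalar_single [simp]: "scalar c (Poly_Mapping.single \<alpha> d) = Poly_Mapping.single \<alpha> (c * d)"
  by (simp add: scalar_def mult_single)

definition op_linear :: "('k::field_char_0, 'n) mpoly_op \<Rightarrow> bool" where
  "op_linear f \<longleftrightarrow> (\<forall>p q. f (p + q) = f p + f q) \<and> (\<forall>c p. f (scalar c p) = scalar c (f p))"

lemma op_linear_zero: "op_linear f \<Longrightarrow> f 0 = 0"
  unfolding op_linear_def by (metis add_cancel_left_left)

lemma op_linear_scalar: "op_linear (scalar c)"
  by (simp add: op_linear_def scalar_add scalar_scalar mult.commute)

lemma op_linear_linear_ext: "op_linear (linear_ext g)"
  by (simp add: op_linear_def linear_ext_add linear_ext_scalar)

lemma op_linear_mult_var: "op_linear (mult_var i)"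
  by (simp add: op_linear_def mult_var_def scalar_def distrib_left mult.left_commute)

lemma op_linear_comp: "op_linear f \<Longrightarrow> op_linear g \<Longrightarrow> op_linear (f \<circ> g)"
  by (simp add: op_linear_def)

lemma op_linear_add: "op_linear f \<Longrightarrow> op_linear g \<Longrightarrow> op_linear (\<lambda>p. f p + g p)"
  by (simp add: op_linear_def scalar_add)

lemma op_linear_H_op: "op_linear (H_op i)"
  by (simp add: H_op_def partial_def op_linear_comp op_linear_linear_ext op_linear_mult_var)

lemma op_linear_generated: "f \<in> generated_subalgebra S \<Longrightarrow> (\<And>s. s \<in> S \<Longrightarrow> op_linear s) \<Longrightarrow> op_linear f"
proof (induction rule: generated_subalgebra.induct)
  case one
  then show ?case by (simp add: op_linear_def)
qed (auto intro: op_linear_comp op_linear_add op_linear_scalar)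

text \<open>A polynomial is a finite sum of monomials, so the operator identities below reduce to
  arithmetic with exponents and coefficients on \<open>Poly_Mapping.single\<close>.\<close>

lemma op_linear_ext:
  fixes f g :: "('k::field_char_0, 'n) mpoly_op"
  assumes f: "op_linear f" and g: "op_linear g"
    and eq: "\<And>\<alpha> c. f (Poly_Mapping.single \<alpha> c) = g (Poly_Mapping.single \<alpha> c)"
  shows "f = g"
proof
  fix p :: "('k, 'n) mpoly"
  show "f p = g p"
  proof (induction p rule: update_induct)
    case const
    then show ?case using f g by (simp add: op_linear_zero)
  next
    case (update p \<alpha> c)
    have "Poly_Mapping.update \<alpha> c p = p + Poly_Mapping.single \<alpha> c"
      using update.hyps
      by (intro poly_mapping_eqI) (auto simp: lookup_update lookup_add lookup_single in_keys_iff when_def)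
    then show ?case using f g eq update.IH by (simp add: op_linear_def)
  qed
qed

lemma integration_single [simp]:
  "integration i (Poly_Mapping.single \<alpha> c) =
    Poly_Mapping.single (\<alpha> + Poly_Mapping.single i 1) (c / (of_nat (Poly_Mapping.lookup \<alpha> i) + 1))"
  by (simp add: integration_def add.commute)

lemma partial_single [simp]:
  "partial i (Poly_Mapping.single \<alpha> c) =
    Poly_Mapping.single (\<alpha> - Poly_Mapping.single i 1) (c * of_nat (Poly_Mapping.lookup \<alpha> i))"
  by (simp add: partial_def)

lemma mult_var_single [simp]:
  "mult_var i (Poly_Mapping.single \<alpha> c) = Poly_Mapping.single (\<alpha> + Poly_Mapping.single i 1) c"
  by (simp add: mult_var_def mult_single add.commute)

lemma H_op_single [simp]:
  "H_op i (Poly_Mapping.single \<alpha> c) =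
    Poly_Mapping.single \<alpha> (c * (of_nat (Poly_Mapping.lookup \<alpha> i) + 1))"
  by (simp add: H_op_def lookup_add algebra_simps)

lemma exponent_minus_plus:
  "Poly_Mapping.lookup \<alpha> i \<noteq> (0::nat) \<Longrightarrow> \<alpha> - Poly_Mapping.single i 1 + Poly_Mapping.single i 1 = \<alpha>"
  by (rule poly_mapping_eqI) (auto simp: lookup_add lookup_minus lookup_single when_def)

lemma op_linear_partial: "op_linear (partial i)"
  by (simp add: partial_def op_linear_linear_ext)

lemma op_linear_integration: "op_linear (integration i)"
  by (simp add: integration_def op_linear_linear_ext)

lemma op_linear_diff: "op_linear f \<Longrightarrow> op_linear g \<Longrightarrow> op_linear (\<lambda>p. f p - g p)"
  by (auto simp: op_linear_def scalar_def algebra_simps)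

lemmas op_linear_intros = op_linear_comp op_linear_add op_linear_diff op_linear_scalar op_linear_H_op
  op_linear_mult_var op_linear_partial op_linear_integration

lemma of_nat_Suc_neq_0: "of_nat n + 1 \<noteq> (0 :: 'k::field_char_0)"
  using of_nat_neq_0[of n, where 'a = 'k] by (simp add: add.commute)

section \<open>Relations between integration, differentiation and the operators H_i\<close>

lemma partial_integration: "partial i \<circ> integration i = (id :: ('k::field_char_0, 'n) mpoly_op)"
proof (rule op_linear_ext)
  show "op_linear id" by (simp add: op_linear_def)
  show "(partial i \<circ> integration i) (Poly_Mapping.single \<alpha> c) = id (Poly_Mapping.single \<alpha> c)"
    for \<alpha> and c :: 'k
    using of_nat_Suc_neq_0[of "Poly_Mapping.lookup \<alpha> i", where 'k = 'k]
    by (simp add: lookup_add add.commute)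
qed (intro op_linear_intros)

text \<open>The monomial x^\<alpha> is an eigenvector of \<open>H_op i\<close> with eigenvalue
  \<alpha>_i + 1, the denominator in \<open>integration i\<close>. Through this identity, stability
  under \<open>integration\<close> and \<open>H_op\<close> yields stability under multiplication by
  variables.\<close>

lemma mult_var_eq: "mult_var i = integration i \<circ> H_op i"
  by (rule op_linear_ext) (simp_all add: op_linear_intros of_nat_Suc_neq_0)

text \<open>Raising the exponent by one raises the eigenvalue of \<open>H_op i\<close> by
  one.\<close>

lemma H_integration:
  "(H_op i \<circ> integration i :: ('k::field_char_0, 'n) mpoly_op) =
    (\<lambda>p. (integration i \<circ> H_op i) p + integration i p)"
proof (rule op_linear_ext)
  fix \<alpha> :: "'n \<Rightarrow>\<^sub>0 nat" and c :: 'k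
  show "(H_op i \<circ> integration i) (Poly_Mapping.single \<alpha> c) =
      (integration i \<circ> H_op i) (Poly_Mapping.single \<alpha> c) + integration i (Poly_Mapping.single \<alpha> c)"
    using of_nat_Suc_neq_0[of "Poly_Mapping.lookup \<alpha> i", where 'k = 'k]
    by (simp add: lookup_add single_add[symmetric]) (intro arg_cong[where f = "Poly_Mapping.single _"], simp add: field_simps)
qed (intro op_linear_intros)+

lemma H_partial:
  "(H_op i \<circ> partial i :: ('k::field_char_0, 'n) mpoly_op) =
    (\<lambda>p. (partial i \<circ> H_op i) p - partial i p)"
proof (rule op_linear_ext)
  fix \<alpha> :: "'n \<Rightarrow>\<^sub>0 nat" and c :: 'k
  show "(H_op i \<circ> partial i) (Poly_Mapping.single \<alpha> c) =
      (partial i \<circ> H_op i) (Poly_Mapping.single \<alpha> c) - partial i (Poly_Mapping.single \<alpha> c)"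
    \<comment> \<open>For exponent 0 the subtraction truncates, but \<open>partial i\<close> kills
      the monomial and both sides vanish.\<close>
    by (cases "Poly_Mapping.lookup \<alpha> i")
      (simp_all add: lookup_minus single_diff[symmetric] algebra_simps op_linear_zero[OF op_linear_H_op])
qed (intro op_linear_intros)+

text \<open>The operator 1 - \<open>integration i \<circ> partial i\<close> projects onto the
  polynomials free of x_i, on which \<open>H_op i\<close> is the identity. This is the source of the
  exceptional coordinate 1.\<close>

lemma constant_projection_H:
  "(\<lambda>p :: ('k::field_char_0, 'n) mpoly. H_op i p - (integration i \<circ> partial i \<circ> H_op i) p) =
    (\<lambda>p. p - (integration i \<circ> partial i) p)"
proof (rule op_linear_ext)
  fix \<alpha> :: "'n \<Rightarrow>\<^sub>0 nat" and c :: 'k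
  show "H_op i (Poly_Mapping.single \<alpha> c) - (integration i \<circ> partial i \<circ> H_op i) (Poly_Mapping.single \<alpha> c) =
      Poly_Mapping.single \<alpha> c - (integration i \<circ> partial i) (Poly_Mapping.single \<alpha> c)"
  proof (cases "Poly_Mapping.lookup \<alpha> i")
    case 0
    then show ?thesis by simp
  next
    case (Suc m)
    then show ?thesis
      using exponent_minus_plus[of \<alpha> i] of_nat_Suc_neq_0[of m, where 'k = 'k]
      by (simp add: lookup_minus single_diff[symmetric]) (intro arg_cong[where f = "Poly_Mapping.single _"], simp add: field_simps)
  qed
  have "op_linear (\<lambda>p. id p - (integration i \<circ> partial i) p)"
    by (intro op_linear_intros) (simp add: op_linear_def)
  then show "op_linear (\<lambda>p. p - (integration i \<circ> partial i) p)" by simp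
qed (intro op_linear_intros)

lemma exponent_shift_commute:
  "i \<noteq> j \<Longrightarrow> \<alpha> - Poly_Mapping.single i (1::nat) + Poly_Mapping.single j 1 =
    \<alpha> + Poly_Mapping.single j 1 - Poly_Mapping.single i 1"
  by (rule poly_mapping_eqI) (auto simp: lookup_add lookup_minus lookup_single when_def)

lemma ops_commute:
  assumes "i \<noteq> j" "P \<in> {integration, partial, H_op}" "Q \<in> {integration, partial, H_op}"
  shows "P i \<circ> Q j = Q j \<circ> P i"
proof (rule op_linear_ext)
  show "op_linear (P i \<circ> Q j)" "op_linear (Q j \<circ> P i)"
    using assms by (auto intro!: op_linear_intros)
  show "(P i \<circ> Q j) (Poly_Mapping.single \<alpha> c) = (Q j \<circ> P i) (Poly_Mapping.single \<alpha> c)" for \<alpha> c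
    using assms exponent_shift_commute[of i j \<alpha>] exponent_shift_commute[of j i \<alpha>]
    by (elim insertE emptyE)
      (simp_all add: lookup_add lookup_minus lookup_single when_def ac_simps diff_diff_eq)
qed

lemma H_commute: "H_op i \<circ> H_op j = H_op j \<circ> H_op i"
  by (rule op_linear_ext) (auto intro!: op_linear_intros simp: ac_simps)

section \<open>Ideal powers and shifts of weights\<close>

lemma integro_diff_algebra_gen:
  "mult_var i \<in> integro_diff_algebra" "partial i \<in> integro_diff_algebra"
  "integration i \<in> integro_diff_algebra" "H_op i \<in> integro_diff_algebra"
  "scalar c \<in> integro_diff_algebra" "id \<in> integro_diff_algebra"
  by (auto simp: integro_diff_algebra_def H_op_def intro!: generated_subalgebra.comp
      intro: generated_subalgebra.gen generated_subalgebra.one scalar_in_generated_subalgebra)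

lemma D_algebra_subset: "f \<in> D_algebra \<Longrightarrow> f \<in> integro_diff_algebra"
  unfolding D_algebra_def
proof (induction rule: generated_subalgebra.induct)
  case (gen f)
  then show ?case using integro_diff_algebra_gen(4) by auto
qed (unfold integro_diff_algebra_def, (rule generated_subalgebra.one generated_subalgebra.scale
    generated_subalgebra.add generated_subalgebra.comp; assumption)+)

lemma zero_in_D_algebra: "(\<lambda>p. 0) \<in> (D_algebra :: ('k::field_char_0, 'n) mpoly_op set)"
proof -
  have "scalar 0 \<in> (D_algebra :: ('k, 'n) mpoly_op set)"
    by (simp add: D_algebra_def scalar_in_generated_subalgebra)
  moreover have "scalar 0 = (\<lambda>p. 0 :: ('k, 'n) mpoly)" by (simp add: fun_eq_iff scalar_def)
  ultimately show ?thesis by simp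
qed

lemma D_algebra_closed:
  "H_op i \<in> D_algebra" "id \<in> D_algebra" "scalar c \<in> D_algebra"
  "a \<in> D_algebra \<Longrightarrow> b \<in> D_algebra \<Longrightarrow> a \<circ> b \<in> D_algebra"
  "a \<in> D_algebra \<Longrightarrow> b \<in> D_algebra \<Longrightarrow> (\<lambda>p. a p + b p) \<in> D_algebra"
  "(\<lambda>p. 0) \<in> D_algebra"
  using zero_in_D_algebra by (auto simp: D_algebra_def intro: generated_subalgebra.intros scalar_in_generated_subalgebra)

lemma op_linear_D: "a \<in> D_algebra \<Longrightarrow> op_linear a"
  unfolding D_algebra_def by (erule op_linear_generated) (auto intro: op_linear_H_op)

text \<open>\<open>generated_ideal\<close> closes its generators under sums only, so absorption of
  factors from D is a separate fact; the left factor distributes over sums because it is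
  linear.\<close>

lemma generated_ideal_comp:
  assumes "f \<in> generated_ideal D_algebra S" "a \<in> D_algebra" "b \<in> D_algebra"
  shows "a \<circ> f \<circ> b \<in> generated_ideal D_algebra S"
  using assms(1)
proof induction
  case zero
  have "a \<circ> (\<lambda>p. 0) \<circ> b = (\<lambda>p. 0)"
    using op_linear_zero[OF op_linear_D[OF assms(2)]] by (simp add: fun_eq_iff)
  then show ?case by (simp only: generated_ideal.zero)
next
  case (gen s a' b')
  then have "(a \<circ> a') \<circ> s \<circ> (b' \<circ> b) \<in> generated_ideal D_algebra S"
    using assms by (intro generated_ideal.gen D_algebra_closed)
  then show ?case by (simp only: comp_assoc)
next
  case (add f g)
  have "a \<circ> (\<lambda>p. f p + g p) \<circ> b = (\<lambda>p. (a \<circ> f \<circ> b) p + (a \<circ> g \<circ> b) p)"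
    using op_linear_D[OF assms(2)] by (simp add: fun_eq_iff op_linear_def)
  then show ?case using generated_ideal.add[OF add.IH] by (simp only:)
qed

lemma generated_ideal_subset:
  assumes "f \<in> generated_ideal D_algebra S" "S \<subseteq> D_algebra"
  shows "f \<in> D_algebra"
  using assms(1)
proof induction
  case (gen s a b)
  then show ?case using assms(2) by (intro D_algebra_closed) auto
qed (use D_algebra_closed in simp_all)

lemma max_ideal_subset: "max_ideal \<mu> \<subseteq> D_algebra"
proof
  fix f assume "f \<in> max_ideal \<mu>"
  then show "f \<in> D_algebra" unfolding max_ideal_def
  proof (rule generated_ideal_subset)
    have "(\<lambda>p. H_op i p - scalar (\<mu> i) p) = (\<lambda>p. H_op i p + scalar (- \<mu> i) p)" for i
      by (simp add: fun_eq_iff scalar_def single_uminus)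
    moreover have "(\<lambda>p. H_op i p + scalar (- \<mu> i) p) \<in> D_algebra" for i
      by (intro D_algebra_closed)
    ultimately show "range (\<lambda>i p. H_op i p - scalar (\<mu> i) p) \<subseteq> D_algebra" by auto
  qed
qed

lemma ideal_power_comp:
  "f \<in> ideal_power D_algebra (max_ideal \<mu>) k \<Longrightarrow> a \<in> D_algebra \<Longrightarrow> b \<in> D_algebra \<Longrightarrow>
    a \<circ> f \<circ> b \<in> ideal_power D_algebra (max_ideal \<mu>) k"
  by (cases k) (auto intro!: D_algebra_closed intro: generated_ideal_comp)

lemma ideal_power_add:
  "f \<in> ideal_power D_algebra (max_ideal \<mu>) k \<Longrightarrow> g \<in> ideal_power D_algebra (max_ideal \<mu>) k \<Longrightarrow>
    (\<lambda>p. f p + g p) \<in> ideal_power D_algebra (max_ideal \<mu>) k"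
  by (cases k) (auto intro!: D_algebra_closed intro: generated_ideal.add)

lemma ideal_power_zero: "(\<lambda>p. 0) \<in> ideal_power D_algebra (max_ideal \<mu>) k"
  by (cases k) (auto intro!: D_algebra_closed intro: generated_ideal.zero)

text \<open>The factor from the maximal ideal lies in D and is absorbed by the lower power. Vectors
  killed by different powers can thus be compared at a common exponent.\<close>

lemma ideal_power_Suc_subset:
  "ideal_power D_algebra (max_ideal \<mu>) (Suc k) \<subseteq> ideal_power D_algebra (max_ideal \<mu>) k"
proof
  fix f assume "f \<in> ideal_power D_algebra (max_ideal \<mu>) (Suc k)"
  then have "f \<in> generated_ideal D_algebra
      {a \<circ> b |a b. a \<in> max_ideal \<mu> \<and> b \<in> ideal_power D_algebra (max_ideal \<mu>) k}" by simp
  then show "f \<in> ideal_power D_algebra (max_ideal \<mu>) k"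
  proof induction
    case (gen s a b)
    then obtain p q where s: "s = p \<circ> q" "p \<in> D_algebra" "q \<in> ideal_power D_algebra (max_ideal \<mu>) k"
      using max_ideal_subset by blast
    then have "(a \<circ> p) \<circ> q \<circ> b \<in> ideal_power D_algebra (max_ideal \<mu>) k"
      using gen by (intro ideal_power_comp D_algebra_closed)
    then show ?case by (simp only: s comp_assoc)
  qed (auto intro: ideal_power_zero ideal_power_add)
qed

lemma ideal_power_antimono:
  "k \<le> l \<Longrightarrow> ideal_power D_algebra (max_ideal \<mu>) l \<subseteq> ideal_power D_algebra (max_ideal \<mu>) k"
  by (rule lift_Suc_antimono_le) (rule ideal_power_Suc_subset)

lemma ideal_power_subset: "ideal_power D_algebra (max_ideal \<mu>) k \<subseteq> D_algebra"
  using ideal_power_antimono[of 0 k \<mu>] by simp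

text \<open>This turns annihilation by a power of the maximal ideal into nilpotency of each single
  H_i - \<mu>_i.\<close>

lemma power_in_ideal_power:
  "(\<lambda>p. H_op i p - scalar (\<mu> i) p) ^^ k \<in> ideal_power D_algebra (max_ideal \<mu>) k"
proof (induction k)
  case 0
  then show ?case using D_algebra_closed(2) by (simp add: id_def)
next
  case (Suc k)
  let ?t = "\<lambda>p. H_op i p - scalar (\<mu> i) p"
  \<comment> \<open>The outer identities give the shape \<open>a \<circ> s \<circ> b\<close> of
    \<open>generated_ideal.gen\<close>.\<close>
  have "id \<circ> ?t \<circ> id \<in> max_ideal \<mu>"
    unfolding max_ideal_def by (intro generated_ideal.gen D_algebra_closed) simp
  then have "id \<circ> (?t \<circ> ?t ^^ k) \<circ> id \<in> ideal_power D_algebra (max_ideal \<mu>) (Suc k)"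
    unfolding ideal_power.simps using Suc by (intro generated_ideal.gen D_algebra_closed) auto
  then show ?case by (simp only: funpow.simps id_comp comp_id)
qed

text \<open>An operator \<open>Z\<close> that moves weights by \<open>\<delta>\<close> intertwines \<open>D_algebra\<close> with itself along the
  translation \<open>H_op j \<mapsto> H_op j + \<delta> j\<close>, which carries the maximal ideal of \<open>\<mu> + \<delta>\<close> to
  that of \<open>\<mu>\<close>.\<close>

definition weight_shift :: "('k::field_char_0, 'n) mpoly_op \<Rightarrow> ('n \<Rightarrow> 'k) \<Rightarrow> bool" where
  "weight_shift Z \<delta> \<longleftrightarrow> op_linear Z \<and> (\<forall>j. H_op j \<circ> Z = Z \<circ> (\<lambda>p. H_op j p + scalar (\<delta> j) p))"

text \<open>Instead of a substitution map on \<open>D_algebra\<close>, the existence of a translate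
  a' is carried through the induction over a; linearity of Z handles sums and scalars.\<close>

lemma weight_shift_D:
  assumes Z: "weight_shift Z \<delta>" and a: "a \<in> D_algebra"
  shows "\<exists>a'\<in>D_algebra. a \<circ> Z = Z \<circ> a'"
  using a unfolding D_algebra_def
proof induction
  case (gen f)
  then obtain j where "f = H_op j" by blast
  with Z have "f \<circ> Z = Z \<circ> (\<lambda>p. H_op j p + scalar (\<delta> j) p)" by (simp add: weight_shift_def)
  moreover have "(\<lambda>p. H_op j p + scalar (\<delta> j) p) \<in> D_algebra" by (intro D_algebra_closed)
  ultimately show ?case unfolding D_algebra_def by blast
next
  case one
  show ?case by (rule bexI[of _ id]) (auto intro: generated_subalgebra.one)
next
  case (scale f c)
  then obtain f' where f': "f' \<in> generated_subalgebra (range H_op)" "f \<circ> Z = Z \<circ> f'" by blast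
  have "scalar c \<circ> f \<circ> Z = Z \<circ> (scalar c \<circ> f')"
    using f'(2) Z by (simp add: comp_assoc weight_shift_def op_linear_def) (simp add: fun_eq_iff)
  then show ?case using generated_subalgebra.scale[OF f'(1), of c] by blast
next
  case (add f g)
  then obtain f' g' where f': "f' \<in> generated_subalgebra (range H_op)" "f \<circ> Z = Z \<circ> f'"
    and g': "g' \<in> generated_subalgebra (range H_op)" "g \<circ> Z = Z \<circ> g'" by blast
  have "(\<lambda>p. f p + g p) \<circ> Z = Z \<circ> (\<lambda>p. f' p + g' p)"
    using f'(2) g'(2) Z by (simp add: fun_eq_iff weight_shift_def op_linear_def)
  then show ?case using generated_subalgebra.add[OF f'(1) g'(1)] by blast
next
  case (comp f g)
  then obtain f' g' where f': "f' \<in> generated_subalgebra (range H_op)" "f \<circ> Z = Z \<circ> f'"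
    and g': "g' \<in> generated_subalgebra (range H_op)" "g \<circ> Z = Z \<circ> g'" by blast
  have "f \<circ> g \<circ> Z = Z \<circ> (f' \<circ> g')"
    using f'(2) g'(2) by (metis comp_assoc)
  then show ?case using generated_subalgebra.comp[OF f'(1) g'(1)] by blast
qed

text \<open>The generating sets are kept abstract to serve both the generators H_i - \<mu>_i and the
  products that define ideal powers.\<close>

lemma weight_shift_generated_ideal:
  assumes Z: "weight_shift Z \<delta>" and S: "\<And>s. s \<in> S \<Longrightarrow> \<exists>s'\<in>S'. s \<circ> Z = Z \<circ> s'"
    and f: "f \<in> generated_ideal D_algebra S"
  shows "\<exists>f'\<in>generated_ideal D_algebra S'. f \<circ> Z = Z \<circ> f'"
  using f
proof induction
  case zero
  have "(\<lambda>p. 0) \<circ> Z = Z \<circ> (\<lambda>p. 0)"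
    using Z op_linear_zero by (auto simp: weight_shift_def fun_eq_iff)
  then show ?case using generated_ideal.zero by blast
next
  case (gen s a b)
  obtain b' where b': "b' \<in> D_algebra" "b \<circ> Z = Z \<circ> b'" using weight_shift_D[OF Z gen(3)] by blast
  obtain s' where s': "s' \<in> S'" "s \<circ> Z = Z \<circ> s'" using S[OF gen(1)] by blast
  obtain a' where a': "a' \<in> D_algebra" "a \<circ> Z = Z \<circ> a'" using weight_shift_D[OF Z gen(2)] by blast
  have "a \<circ> s \<circ> b \<circ> Z = Z \<circ> (a' \<circ> s' \<circ> b')"
    using a'(2) b'(2) s'(2) by (metis comp_assoc)
  then show ?case using generated_ideal.gen[OF s'(1) a'(1) b'(1)] by blast
next
  case (add f g)
  then obtain f' g' where f': "f' \<in> generated_ideal D_algebra S'" "f \<circ> Z = Z \<circ> f'"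
    and g': "g' \<in> generated_ideal D_algebra S'" "g \<circ> Z = Z \<circ> g'" by blast
  have "(\<lambda>p. f p + g p) \<circ> Z = Z \<circ> (\<lambda>p. f' p + g' p)"
    using f'(2) g'(2) Z by (simp add: fun_eq_iff weight_shift_def op_linear_def)
  then show ?case using generated_ideal.add[OF f'(1) g'(1)] by blast
qed

text \<open>On generators the shift cancels: (H_i - \<mu>_i - \<delta>_i) Z = Z (H_i -
  \<mu>_i).\<close>

lemma weight_shift_max_ideal:
  assumes Z: "weight_shift Z \<delta>" and f: "f \<in> max_ideal (\<lambda>j. \<mu> j + \<delta> j)"
  shows "\<exists>f'\<in>max_ideal \<mu>. f \<circ> Z = Z \<circ> f'"
  unfolding max_ideal_def
proof (rule weight_shift_generated_ideal[OF Z _ f[unfolded max_ideal_def]])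
  fix s assume "s \<in> range (\<lambda>i p. H_op i p - scalar (\<mu> i + \<delta> i) p)"
  then obtain i where s: "s = (\<lambda>p. H_op i p - scalar (\<mu> i + \<delta> i) p)" by blast
  have lin: "Z (p + q) = Z p + Z q" "Z (scalar c p) = scalar c (Z p)" for p q c
    using Z by (auto simp: weight_shift_def op_linear_def)
  have lin': "Z (p - q) = Z p - Z q" for p q
    using lin(1)[of "p - q" q] by (simp add: eq_diff_eq)
  have "H_op i (Z p) = Z (H_op i p) + scalar (\<delta> i) (Z p)" for p
    using Z by (simp add: weight_shift_def fun_eq_iff lin)
  then have "s \<circ> Z = Z \<circ> (\<lambda>p. H_op i p - scalar (\<mu> i) p)"
    by (simp add: s fun_eq_iff lin lin' scalar_add_left)
  then show "\<exists>s'\<in>range (\<lambda>i p. H_op i p - scalar (\<mu> i) p). s \<circ> Z = Z \<circ> s'" by blast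
qed

text \<open>The exponent k is preserved, so Z sends a vector killed by the k-th power at \<mu> to
  one killed by the k-th power at \<mu> + \<delta>.\<close>

lemma weight_shift_ideal_power:
  assumes Z: "weight_shift Z \<delta>"
  shows "f \<in> ideal_power D_algebra (max_ideal (\<lambda>j. \<mu> j + \<delta> j)) k \<Longrightarrow>
    \<exists>f'\<in>ideal_power D_algebra (max_ideal \<mu>) k. f \<circ> Z = Z \<circ> f'"
proof (induction k arbitrary: f)
  case 0
  then have "f \<in> D_algebra" by simp
  from weight_shift_D[OF Z this] show ?case by (simp only: ideal_power.simps)
next
  case (Suc k)
  show ?case unfolding ideal_power.simps
  proof (rule weight_shift_generated_ideal[OF Z _ Suc.prems[unfolded ideal_power.simps]])
    fix s assume "s \<in> {a \<circ> b |a b. a \<in> max_ideal (\<lambda>j. \<mu> j + \<delta> j) \<and>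
        b \<in> ideal_power D_algebra (max_ideal (\<lambda>j. \<mu> j + \<delta> j)) k}"
    then obtain a b where s: "s = a \<circ> b" "a \<in> max_ideal (\<lambda>j. \<mu> j + \<delta> j)"
      "b \<in> ideal_power D_algebra (max_ideal (\<lambda>j. \<mu> j + \<delta> j)) k" by blast
    obtain a' where a': "a' \<in> max_ideal \<mu>" "a \<circ> Z = Z \<circ> a'"
      using weight_shift_max_ideal[OF Z s(2)] by blast
    obtain b' where b': "b' \<in> ideal_power D_algebra (max_ideal \<mu>) k" "b \<circ> Z = Z \<circ> b'"
      using Suc.IH[OF s(3)] by blast
    have "s \<circ> Z = Z \<circ> (a' \<circ> b')" using a'(2) b'(2) unfolding s(1) by (metis comp_assoc)
    then show "\<exists>s'\<in>{a \<circ> b |a b. a \<in> max_ideal \<mu> \<and> b \<in> ideal_power D_algebra (max_ideal \<mu>) k}. s \<circ> Z = Z \<circ> s'"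
      using a'(1) b'(1) by blast
  qed
qed

section \<open>The shifts of the basic operators\<close>

lemma weight_shift_integration:
  "weight_shift (integration i :: ('k::field_char_0, 'n) mpoly_op) (\<lambda>j. if j = i then 1 else 0)"
  unfolding weight_shift_def
proof (intro conjI allI op_linear_integration)
  fix j
  have Z_add: "integration i (p + q) = integration i p + integration i q" for p q :: "('k, 'n) mpoly"
    by (simp add: op_linear_integration[unfolded op_linear_def])
  show "H_op j \<circ> (integration i :: ('k, 'n) mpoly_op) = integration i \<circ> (\<lambda>p. H_op j p + scalar (if j = i then 1 else 0) p)"
  proof (cases "j = i")
    case True
    then show ?thesis by (simp add: H_integration fun_eq_iff Z_add scalar_def)
  next
    case False
    then show ?thesis using ops_commute[of j i H_op integration] by (simp add: fun_eq_iff scalar_def)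
  qed
qed

lemma weight_shift_partial:
  "weight_shift (partial i :: ('k::field_char_0, 'n) mpoly_op) (\<lambda>j. if j = i then - 1 else 0)"
  unfolding weight_shift_def
proof (intro conjI allI op_linear_partial)
  fix j
  have Z_add: "partial i (p + q) = partial i p + partial i q" for p q :: "('k, 'n) mpoly"
    by (simp add: op_linear_partial[unfolded op_linear_def])
  have diff: "partial i (p - q) = partial i p - partial i q" for p q :: "('k, 'n) mpoly"
    using Z_add[of "p - q" q] by (simp add: eq_diff_eq)
  show "H_op j \<circ> (partial i :: ('k, 'n) mpoly_op) = partial i \<circ> (\<lambda>p. H_op j p + scalar (if j = i then - 1 else 0) p)"
  proof (cases "j = i")
    case True
    then show ?thesis by (simp add: H_partial fun_eq_iff diff scalar_def single_uminus)
  next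
    case False
    then show ?thesis using ops_commute[of j i H_op partial] by (simp add: fun_eq_iff scalar_def)
  qed
qed

lemma weight_shift_H_op: "weight_shift (H_op i) (\<lambda>j. 0)"
  using H_commute by (auto simp: weight_shift_def op_linear_H_op scalar_def)

text \<open>With scalars as a shift by 0, closure of weight components under scaling is an instance
  of the general shift argument.\<close>

lemma weight_shift_scalar:
  "weight_shift (scalar c :: ('k::field_char_0, 'n) mpoly_op) (\<lambda>j. 0)"
proof -
  have "H_op j (scalar c p) = scalar c (H_op j p)" for j and p :: "('k, 'n) mpoly"
    by (simp add: op_linear_H_op[unfolded op_linear_def])
  moreover have "scalar 0 p = 0" for p :: "('k, 'n) mpoly"
    by (simp add: scalar_def)
  ultimately show ?thesis
    by (simp add: weight_shift_def op_linear_scalar fun_eq_iff)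
qed

section \<open>Weight decompositions\<close>

lemma dim_at_mostI:
  assumes "vector_space scl" "module.subspace scl V" "finite C" "V \<subseteq> module.span scl C" "card C \<le> d"
  shows "dim_at_most scl V d"
proof -
  interpret vector_space scl by fact
  \<comment> \<open>\<open>dim_at_most\<close> demands a finite set spanning exactly
    \<open>V\<close>, while \<open>C\<close> may lie outside \<open>V\<close>. A basis inside
    \<open>V\<close> is finite, being independent in \<open>span C\<close>.\<close>
  obtain B where B: "B \<subseteq> V" "independent B" "V \<subseteq> span B" "card B = dim V"
    using basis_exists[of V] by blast
  have "finite B" using independent_span_bound[OF assms(3) B(2)] B(1) assms(4) by blast
  moreover have "span B = V"
    using B assms(2) by (metis span_subspace)
  moreover have "dim V \<le> d"
    using dim_le_card[OF assms(4,3)] assms(5) by linarith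
  ultimately show ?thesis unfolding dim_at_most_def by blast
qed

lemma dim_at_mostE:
  assumes "dim_at_most scl V d" "vector_space scl"
  obtains B where "finite B" "module.span scl B = V" "card B \<le> d"
proof -
  interpret vector_space scl by fact
  obtain C where C: "finite C" "span C = V" and d: "dim V \<le> d"
    using assms(1) unfolding dim_at_most_def by blast
  obtain B where B: "B \<subseteq> V" "independent B" "V \<subseteq> span B" "card B = dim V"
    using basis_exists[of V] by blast
  have "finite B" using independent_span_bound[OF C(1) B(2)] B(1) C(2) by blast
  moreover have "span B = V"
    using B C by (metis span_subspace subspace_span)
  ultimately show ?thesis using that B(4) d by simp
qed

lemma dim_at_most_image:
  assumes "dim_at_most scl V d" "Vector_Spaces.linear scl scl f"
  shows "dim_at_most scl (f ` V) d"
proof -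
  interpret f: Vector_Spaces.linear scl scl f by fact
  have vs: "vector_space scl" by (rule f.vs1.vector_space_axioms)
  obtain B where B: "finite B" "f.vs1.span B = V" "card B \<le> d"
    using dim_at_mostE[OF assms(1) vs] by blast
  show ?thesis
  proof (rule dim_at_mostI[OF vs])
    show "f.vs1.subspace (f ` V)"
      using B(2) f.subspace_image f.vs1.subspace_span by blast
    show "finite (f ` B)" "card (f ` B) \<le> d"
      using B card_image_le[of B f] by (auto intro: order_trans)
    show "f ` V \<subseteq> f.vs1.span (f ` B)"
      using B(2) by (simp add: f.span_image)
  qed
qed

text \<open>Each coordinate is moved up, if necessary, past all nonpositive integers; later upward
  moves then never start at coordinate 0.\<close>

lemma orbit_representative:
  fixes \<mu> :: "'n \<Rightarrow> 'k::field_char_0"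
  obtains \<kappa> where "\<And>i k. \<kappa> i \<noteq> - of_nat k"
    and "\<And>\<nu>. \<nu> \<in> translation_orbit \<mu> \<Longrightarrow> \<exists>z. \<nu> = (\<lambda>i. \<kappa> i + of_int (z i))"
proof -
  have "\<exists>m::nat. \<forall>k. \<mu> i + of_nat m \<noteq> - of_nat k" for i
  proof (cases "\<exists>k0. \<mu> i = - of_nat k0")
    case True
    then obtain k0 where k0: "\<mu> i = - of_nat k0" by blast
    \<comment> \<open>The shift by \<open>Suc k0\<close> takes -k0 to 1, the first value above the
      wall.\<close>
    have "\<mu> i + of_nat (Suc k0) \<noteq> - of_nat k" for k
    proof
      assume "\<mu> i + of_nat (Suc k0) = - of_nat k"
      then have "(of_nat (Suc k) :: 'k) = 0" using k0 by (simp add: eq_neg_iff_add_eq_0)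
      then show False by (simp only: of_nat_eq_0_iff)
    qed
    then show ?thesis by blast
  next
    case False
    then show ?thesis by (intro exI[of _ 0]) auto
  qed
  then obtain m where m: "\<And>i k. \<mu> i + of_nat (m i) \<noteq> - of_nat k" by metis
  show thesis
  proof (rule that[of "\<lambda>i. \<mu> i + of_nat (m i)"])
    fix \<nu> assume "\<nu> \<in> translation_orbit \<mu>"
    then obtain z where z: "\<nu> = (\<lambda>i. \<mu> i + of_int (z i))"
      unfolding translation_orbit_def by blast
    show "\<exists>z. \<nu> = (\<lambda>i. \<mu> i + of_nat (m i) + of_int (z i))"
      by (rule exI[of _ "\<lambda>i. z i - int (m i)"]) (simp add: z)
  qed (rule m)
qed

text \<open>\<open>X i\<close>, \<open>Y i\<close> and \<open>H i\<close> abstract the actions of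
  integration, differentiation and H_i. Powers of maximal ideals enter only through the nilpotency
  of each H_i - \<mu>_i on single vectors of \<open>M \<mu>\<close>.\<close>

locale weight_decomposition = vector_space scl
  for scl :: "'k::field_char_0 \<Rightarrow> 'm::ab_group_add \<Rightarrow> 'm" +
  fixes X Y H :: "'n::finite \<Rightarrow> 'm \<Rightarrow> 'm" and M :: "('n \<Rightarrow> 'k) \<Rightarrow> 'm set"
  assumes linear_op: "P \<in> {X, Y, H} \<Longrightarrow> Vector_Spaces.linear scl scl (P i)"
    and op_commute: "P \<in> {X, Y, H} \<Longrightarrow> Q \<in> {X, Y, H} \<Longrightarrow> i \<noteq> j \<Longrightarrow> P i (Q j v) = Q j (P i v)"
    and YX: "Y i (X i v) = v"
    and HX: "H i (X i v) = X i (H i v) + X i v"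
    and HY: "H i (Y i v) = Y i (H i v) - Y i v"
    and XYH: "H i v - X i (Y i (H i v)) = v - X i (Y i v)"
    and subspace_M: "subspace (M \<mu>)"
    and M_X: "v \<in> M \<mu> \<Longrightarrow> X i v \<in> M (\<mu>(i := \<mu> i + 1))"
    and M_Y: "v \<in> M \<mu> \<Longrightarrow> Y i v \<in> M (\<mu>(i := \<mu> i - 1))"
    and M_H: "v \<in> M \<mu> \<Longrightarrow> H i v \<in> M \<mu>"
    and H_nilpotent: "v \<in> M \<mu> \<Longrightarrow> \<exists>k. ((\<lambda>w. H i w - scl (\<mu> i) w) ^^ k) v = 0"
    and decomposition: "direct_sum_decomposition M"
begin

section \<open>Maps between neighbouring weight components\<close>

sublocale X: Vector_Spaces.linear scl scl "X i" for i by (rule linear_op) simp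
sublocale Y: Vector_Spaces.linear scl scl "Y i" for i by (rule linear_op) simp
sublocale H: Vector_Spaces.linear scl scl "H i" for i by (rule linear_op) simp

text \<open>For the module these are exactly the submodules, since x_i acts as \<open>H i\<close>
  followed by \<open>X i\<close>.\<close>

definition stable :: "'m set \<Rightarrow> bool" where
  "stable N \<longleftrightarrow> subspace N \<and> (\<forall>i. \<forall>v\<in>N. X i v \<in> N \<and> Y i v \<in> N \<and> H i v \<in> N)"

text \<open>With E = 1 - X_i Y_i and h = H_i - \<mu>_i, the relation \<open>XYH\<close> gives E h =
  (1 - \<mu>_i) E. Some power of h kills v, so a power of 1 - \<mu>_i annihilates E v, and E v = 0
  because \<mu>_i \<noteq> 1.\<close>

lemma XY:
  assumes v: "v \<in> M \<mu>" and ne: "\<mu> i \<noteq> 1"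
  shows "X i (Y i v) = v"
proof -
  define E where "E w = w - X i (Y i w)" for w
  define h where "h w = H i w - scl (\<mu> i) w" for w
  have h: "E (h w) = scl (1 - \<mu> i) (E w)" for w
    using XYH[of i w]
    by (simp add: E_def h_def X.diff Y.diff X.scale Y.scale scale_left_diff_distrib
        scale_right_diff_distrib algebra_simps)
  have hk: "E ((h ^^ k) v) = scl ((1 - \<mu> i) ^ k) (E v)" for k
    by (induction k) (simp_all add: h)
  obtain k where "(h ^^ k) v = 0"
    using H_nilpotent[OF v, of i] unfolding h_def by blast
  then have "E ((h ^^ k) v) = 0" by (simp add: E_def)
  with hk[of k] ne have "E v = 0" by simp
  then show ?thesis by (simp add: E_def)
qed

text \<open>By \<open>YX\<close>, the vector \<open>X i v\<close> is a preimage of v, on either side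
  of the wall.\<close>

lemma M_down: "M (\<mu>(i := \<mu> i - 1)) = Y i ` M \<mu>"
proof
  show "Y i ` M \<mu> \<subseteq> M (\<mu>(i := \<mu> i - 1))" using M_Y by blast
  show "M (\<mu>(i := \<mu> i - 1)) \<subseteq> Y i ` M \<mu>"
  proof
    fix v assume "v \<in> M (\<mu>(i := \<mu> i - 1))"
    from M_X[OF this, of i] have "X i v \<in> M \<mu>" by simp
    moreover have "v = Y i (X i v)" by (simp add: YX)
    ultimately show "v \<in> Y i ` M \<mu>" by blast
  qed
qed

text \<open>The preimage of v is \<open>Y i v\<close>; \<open>XY\<close> is used at the upper
  weight, whose coordinate \<mu>_i + 1 must differ from 1.\<close>

lemma M_up:
  assumes "\<mu> i \<noteq> 0"
  shows "M (\<mu>(i := \<mu> i + 1)) = X i ` M \<mu>"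
proof
  show "X i ` M \<mu> \<subseteq> M (\<mu>(i := \<mu> i + 1))" using M_X by blast
  show "M (\<mu>(i := \<mu> i + 1)) \<subseteq> X i ` M \<mu>"
  proof
    fix v assume v: "v \<in> M (\<mu>(i := \<mu> i + 1))"
    from M_Y[OF this, of i] have "Y i v \<in> M \<mu>" by simp
    moreover have "v = X i (Y i v)" using XY[OF v, of i] assms by simp
    ultimately show "v \<in> X i ` M \<mu>" by blast
  qed
qed

text \<open>From a weight without coordinates in \<open>{0, -1, -2, \<dots>}\<close>, the maps \<open>X i\<close> never have to
  cross the wall between the coordinates 0 and 1, where they can fail to be surjective.\<close>

lemma orbit_induct:
  assumes base: "Q (M \<kappa>)"
    and QX: "\<And>i V. Q V \<Longrightarrow> Q (X i ` V)" and QY: "\<And>i V. Q V \<Longrightarrow> Q (Y i ` V)"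
    and \<kappa>: "\<And>i k. \<kappa> i \<noteq> - of_nat k"
  shows "Q (M (\<lambda>j. \<kappa> j + of_int (z j)))"
proof -
  \<comment> \<open>One coordinate is moved at a time; \<open>T\<close> collects those already
    moved.\<close>
  have "Q (M (\<lambda>j. if j \<in> T then \<kappa> j + of_int (z j) else \<kappa> j))" if "finite T" for T
    using that
  proof (induction T)
    case empty
    show ?case using base by simp
  next
    case (insert i T)
    define \<nu> where "\<nu> = (\<lambda>j. if j \<in> T then \<kappa> j + of_int (z j) else \<kappa> j)"
    have \<nu>i: "\<nu> i = \<kappa> i" using insert by (simp add: \<nu>_def)
    have "Q (M (\<nu>(i := \<kappa> i + of_int m)))" for m
    proof (induction m rule: int_induct[where k = 0])
      case base
      then show ?case using insert.IH \<nu>i by (simp add: \<nu>_def[symmetric] fun_upd_idem)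
    next
      case (step1 m)
      \<comment> \<open>Upward steps have m \<ge> 0, so reaching 0 would make \<kappa>_i a
        nonpositive integer.\<close>
      have "\<kappa> i + of_int m \<noteq> 0"
      proof
        assume "\<kappa> i + of_int m = 0"
        then have "\<kappa> i = - of_nat (nat m)" using step1.hyps by (simp add: eq_neg_iff_add_eq_0)
        with \<kappa> show False by blast
      qed
      with M_up[of "\<nu>(i := \<kappa> i + of_int m)" i]
      have eq: "M (\<nu>(i := \<kappa> i + of_int (m + 1))) = X i ` M (\<nu>(i := \<kappa> i + of_int m))"
        by (simp add: add.assoc)
      show ?case unfolding eq by (rule QX[OF step1.IH])
    next
      case (step2 m)
      have eq: "M (\<nu>(i := \<kappa> i + of_int (m - 1))) = Y i ` M (\<nu>(i := \<kappa> i + of_int m))"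
        using M_down[of "\<nu>(i := \<kappa> i + of_int m)" i] by (simp add: add_diff_eq)
      show ?case unfolding eq by (rule QY[OF step2.IH])
    qed
    moreover have "\<nu>(i := \<kappa> i + of_int (z i)) =
        (\<lambda>j. if j \<in> insert i T then \<kappa> j + of_int (z j) else \<kappa> j)"
      by (auto simp: \<nu>_def fun_eq_iff)
    ultimately show ?case by metis
  qed
  from this[of UNIV] show ?thesis by simp
qed

text \<open>A graded subspace with finite-dimensional components that is stable only under the operators
  with index in \<open>T\<close>; in the remaining directions it has not yet spread from \<open>\<kappa>\<close>.\<close>

definition partial_submodule :: "('n \<Rightarrow> 'k) \<Rightarrow> 'n set \<Rightarrow> (('n \<Rightarrow> 'k) \<Rightarrow> 'm set) \<Rightarrow> bool" where
  "partial_submodule \<kappa> T N \<longleftrightarrow>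
    (\<forall>\<mu>. subspace (N \<mu>) \<and> N \<mu> \<subseteq> M \<mu> \<and> (\<exists>C. finite C \<and> N \<mu> \<subseteq> span C)) \<and>
    (\<forall>\<mu>. \<forall>j\<in>T. \<forall>u\<in>N \<mu>. X j u \<in> N (\<mu>(j := \<mu> j + 1)) \<and> Y j u \<in> N (\<mu>(j := \<mu> j - 1)) \<and> H j u \<in> N \<mu>) \<and>
    (\<forall>\<mu>. N \<mu> \<noteq> {0} \<longrightarrow> (\<forall>j. if j \<in> T then \<exists>z. \<mu> j = \<kappa> j + of_int z else \<mu> j = \<kappa> j))"

text \<open>The new components are spanned by the ordered words X^a Y^b h^c in direction i, applied
  to vectors u of \<open>N\<close> whose i-th weight coordinate is still \<kappa>_i. The relations
  rewrite X, Y or H times such a word into such words again.\<close>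

lemma partial_submodule_insert:
  assumes N: "partial_submodule \<kappa> T N" and i: "i \<notin> T" and v: "v \<in> N \<kappa>"
  shows "\<exists>N'. partial_submodule \<kappa> (insert i T) N' \<and> v \<in> N' \<kappa>"
proof -
  define h where "h w = H i w - scl (\<kappa> i) w" for w
  define F where "F a b c u = (X i ^^ a) ((Y i ^^ b) ((h ^^ c) u))" for a b c u
  \<comment> \<open>\<open>F a b c\<close> moves the i-th coordinate from \<kappa>_i to \<kappa>_i +
    a - b; \<open>R \<mu>\<close> collects the exponents that land in weight \<mu>.\<close>
  define R where "R \<mu> = {(a, b). \<mu> i + of_nat b = \<kappa> i + of_nat a}" for \<mu> :: "'n \<Rightarrow> 'k"
  define G where "G \<mu> = {F a b c u |a b c u. (a, b) \<in> R \<mu> \<and> u \<in> N (\<mu>(i := \<kappa> i))}" for \<mu>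
  define N' where "N' \<mu> = span (G \<mu>)" for \<mu>
  from N have subN: "\<And>\<mu>. subspace (N \<mu>)" and NM: "\<And>\<mu>. N \<mu> \<subseteq> M \<mu>"
    and fdN: "\<And>\<mu>. \<exists>C. finite C \<and> N \<mu> \<subseteq> span C"
    and opN: "\<And>\<mu> j u. j \<in> T \<Longrightarrow> u \<in> N \<mu> \<Longrightarrow>
       X j u \<in> N (\<mu>(j := \<mu> j + 1)) \<and> Y j u \<in> N (\<mu>(j := \<mu> j - 1)) \<and> H j u \<in> N \<mu>"
    and suppN: "\<And>\<mu> j. N \<mu> \<noteq> {0} \<Longrightarrow> if j \<in> T then \<exists>z. \<mu> j = \<kappa> j + of_int z else \<mu> j = \<kappa> j"
    unfolding partial_submodule_def by blast+
  have lin_h: "Vector_Spaces.linear scl scl h"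
    unfolding h_def by unfold_locales (simp_all add: H.add H.scale scale_right_distrib scale_right_diff_distrib scale_left_commute)
  have lin_pow: "Vector_Spaces.linear scl scl (f ^^ k)" if "Vector_Spaces.linear scl scl f" for f k
  proof (induction k)
    case 0 show ?case using linear_id by (simp add: id_def)
  next
    case (Suc k) show ?case using Vector_Spaces.linear_compose[OF Suc that] by (simp only: funpow.simps)
  qed
  have lin_0: "f 0 = 0" if "Vector_Spaces.linear scl scl f" for f
    by (rule module_hom.zero[OF Vector_Spaces.linear.axioms(3)[OF that]])
  have lin_F: "Vector_Spaces.linear scl scl (F a b c)" for a b c
    using Vector_Spaces.linear_compose[OF Vector_Spaces.linear_compose[OF lin_pow[OF lin_h, of c] lin_pow[OF linear_op[of Y], of b]]
        lin_pow[OF linear_op[of X], of a]]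
    unfolding F_def by (simp add: comp_def)
  have M_h: "(h ^^ c) u \<in> M \<mu>" if "u \<in> M \<mu>" for c u \<mu>
    using that by (induction c) (auto simp: h_def intro!: subspace_diff subspace_scale subspace_M M_H)
  have M_Yb: "(Y i ^^ b) u \<in> M (\<mu>(i := \<mu> i - of_nat b))" if "u \<in> M \<mu>" for b u \<mu>
  proof (induction b)
    case (Suc b)
    have "(Y i ^^ b) u \<in> M (\<mu>(i := \<mu> i - of_nat b))" by (rule Suc)
    from M_Y[OF this, of i] show "(Y i ^^ Suc b) u \<in> M (\<mu>(i := \<mu> i - of_nat (Suc b)))"
      by (simp add: algebra_simps)
  qed (use that in simp)
  have M_Xa: "(X i ^^ a) u \<in> M (\<mu>(i := \<mu> i + of_nat a))" if "u \<in> M \<mu>" for a u \<mu>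
  proof (induction a)
    case (Suc a)
    have "(X i ^^ a) u \<in> M (\<mu>(i := \<mu> i + of_nat a))" by (rule Suc)
    from M_X[OF this, of i] show "(X i ^^ Suc a) u \<in> M (\<mu>(i := \<mu> i + of_nat (Suc a)))"
      by (simp add: algebra_simps)
  qed (use that in simp)
  have M_F: "F a b c u \<in> M \<mu>" if ab: "(a, b) \<in> R \<mu>" and u: "u \<in> M (\<mu>(i := \<kappa> i))" for a b c u \<mu>
  proof -
    have "F a b c u \<in> M (\<mu>(i := \<kappa> i - of_nat b + of_nat a))"
      using M_Xa[OF M_Yb[OF M_h[OF u]], of a b c] by (simp add: F_def)
    moreover have "\<kappa> i - of_nat b + of_nat a = \<mu> i"
      using ab by (simp add: R_def algebra_simps)
    ultimately show ?thesis by simp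
  qed
  have N'M: "N' \<mu> \<subseteq> M \<mu>" for \<mu>
  proof -
    have "G \<mu> \<subseteq> M \<mu>" unfolding G_def using M_F NM by blast
    then show ?thesis unfolding N'_def by (rule span_minimal[OF _ subspace_M])
  qed
  have fdN': "\<exists>C. finite C \<and> N' \<mu> \<subseteq> span C" for \<mu>
  proof -
    \<comment> \<open>Three parameters are made finite: u runs over a spanning set \<open>C\<close>,
      c stays below a nilpotency exponent \<open>K\<close>, and (a, b) runs over
      \<open>W\<close>.\<close>
    let ?\<nu> = "\<mu>(i := \<kappa> i)"
    obtain C0 where C0: "finite C0" "N ?\<nu> \<subseteq> span C0" using fdN by blast
    obtain C where C: "finite C" "span C = N ?\<nu>"
      using dim_at_mostE[OF dim_at_mostI[OF vector_space_axioms subN C0 order_refl] vector_space_axioms]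
      by blast
    have CM: "C \<subseteq> M ?\<nu>" using C(2) span_superset NM by blast
    have "\<forall>c\<in>C. \<exists>k. (h ^^ k) c = 0" using H_nilpotent[of _ ?\<nu> i] CM unfolding h_def by auto
    then obtain k where k: "\<And>c. c \<in> C \<Longrightarrow> (h ^^ k c) c = 0" by metis
    \<comment> \<open>A common nilpotency exponent on \<open>C\<close>; for empty \<open>C\<close>
      every claim about it is vacuous.\<close>
    define K where "K = Max (k ` C)"
    have hK: "(h ^^ m) c = 0" if "c \<in> C" "m \<ge> K" for m c
    proof -
      have "k c \<le> m" using that C(1) unfolding K_def by (meson Max_ge finite_imageI imageI order_trans)
      then have "(h ^^ m) c = (h ^^ (m - k c)) ((h ^^ k c) c)"
        by (metis comp_apply funpow_add le_add_diff_inverse2)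
      also have "\<dots> = 0"
        using k[OF that(1)] lin_pow[OF lin_h] by (simp add: lin_0)
      finally show ?thesis .
    qed
    \<comment> \<open>Away from the wall, \<open>X i \<circ> Y i\<close> is the identity, so \<open>F (Suc a) (Suc b)\<close> reduces to \<open>F a b\<close>
      and finitely many pairs \<open>(a, b)\<close> suffice.\<close>
    define W where "W = {(a, b). (a, b) \<in> R \<mu> \<and> (a = 0 \<or> b = 0 \<or> \<kappa> i = of_nat b)}"
    have inj1: "a = a'" if "(a, b) \<in> R \<mu>" "(a', b) \<in> R \<mu>" for a a' b
      using that by (auto simp: R_def)
    have inj2: "b = b'" if "(a, b) \<in> R \<mu>" "(a, b') \<in> R \<mu>" for a b b'
      using that by (auto simp: R_def) (metis add_left_cancel of_nat_eq_iff)
    have finW: "finite W"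
    proof -
      \<comment> \<open>On \<open>R \<mu>\<close> the difference a - b is fixed, so either exponent
        determines the other and each of the three conditions leaves finitely many pairs.\<close>
      have "inj_on fst (R \<mu>)" "inj_on snd (R \<mu>)"
        using inj1 inj2 by (auto simp: inj_on_def)
      moreover have "finite {b. \<kappa> i = of_nat b}"
      proof (cases "\<exists>b. \<kappa> i = of_nat b")
        case True
        then obtain b where "\<kappa> i = of_nat b" by blast
        then have "{b. \<kappa> i = of_nat b} = {b}" by auto
        then show ?thesis by simp
      qed simp
      ultimately have "finite (fst -` {0} \<inter> R \<mu> \<union> snd -` {0} \<inter> R \<mu> \<union> snd -` {b. \<kappa> i = of_nat b} \<inter> R \<mu>)"
        by (intro finite_UnI finite_vimage_IntI) simp_all
      then show ?thesis by (rule finite_subset[rotated]) (auto simp: W_def)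
    qed
    have W: "\<exists>(a', b')\<in>W. F a b c u = F a' b' c u" if "(a, b) \<in> R \<mu>" "u \<in> M ?\<nu>" for a b c u
      using that(1)
    proof (induction a arbitrary: b)
      case 0
      then show ?case by (intro bexI[of _ "(0, b)"]) (auto simp: W_def)
    next
      case (Suc a)
      show ?case
      proof (cases "(Suc a, b) \<in> W")
        case True
        then show ?thesis by blast
      next
        case False
        with Suc.prems obtain b' where b: "b = Suc b'" and ne: "\<kappa> i \<noteq> of_nat b"
          by (cases b) (auto simp: W_def)
        have "(a, b') \<in> R \<mu>" using Suc.prems by (simp add: R_def b)
        moreover have "F (Suc a) b c u = F a b' c u"
        proof -
          \<comment> \<open>\<open>XY\<close> needs \<kappa>_i - b' \<noteq> 1, that is \<kappa>_i
            \<noteq> \<open>Suc b'\<close>; hence the third alternative in \<open>W\<close>, which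
            keeps the one b where the wall blocks cancellation.\<close>
          have "(Y i ^^ b') ((h ^^ c) u) \<in> M (?\<nu>(i := \<kappa> i - of_nat b'))"
            using M_Yb[OF M_h[OF that(2)], of b' c] by simp
          from XY[OF this, of i] ne
          have "X i (Y i ((Y i ^^ b') ((h ^^ c) u))) = (Y i ^^ b') ((h ^^ c) u)"
            by (simp add: b algebra_simps)
          then show ?thesis by (simp add: F_def b funpow_swap1)
        qed
        ultimately show ?thesis using Suc.IH by metis
      qed
    qed
    define D where "D = (\<lambda>((a, b), c, u). F a b c u) ` (W \<times> {..<K} \<times> C)"
    have "F a b c u \<in> span D" if ab: "(a, b) \<in> R \<mu>" and "u \<in> N ?\<nu>" for a b c u
    proof -
      \<comment> \<open>By linearity it suffices to take u in the spanning set
        \<open>C\<close>.\<close>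
      have sub: "subspace {u. F a b c u \<in> span D}"
        using Vector_Spaces.linear.axioms(3)[OF lin_F[of a b c]] module_hom.subspace_vimage[of scl scl "F a b c" "span D"]
        by (simp add: vimage_def subspace_span)
      have "C \<subseteq> {u. F a b c u \<in> span D}"
      proof
        fix u assume u: "u \<in> C"
        obtain a' b' where ab': "(a', b') \<in> W" "F a b c u = F a' b' c u"
          using W[OF ab, of u c] u CM by blast
        show "u \<in> {u. F a b c u \<in> span D}"
        proof (cases "c < K")
          case True
          have "F a' b' c u \<in> D" unfolding D_def using True ab' u by force
          then show ?thesis using ab' by (simp add: span_base)
        next
          case False
          then have "F a b c u = 0"
            using hK[OF u, of c] lin_0[OF lin_F[of a b 0]] by (simp add: F_def)
          then show ?thesis by (simp add: span_zero)
        qed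
      qed
      from span_minimal[OF this sub] C(2) that(2) show ?thesis by auto
    qed
    then have "N' \<mu> \<subseteq> span D"
      unfolding N'_def by (intro span_minimal subspace_span) (auto simp: G_def)
    moreover have "finite D" unfolding D_def using finW C by blast
    ultimately show ?thesis by blast
  qed
  \<comment> \<open>Invariance of the spans is checked on the words alone.\<close>
  have span_image_sub: "f w \<in> N' \<nu>" if f: "Vector_Spaces.linear scl scl f" and w: "w \<in> N' \<mu>"
    and g: "\<And>a b c u. (a, b) \<in> R \<mu> \<Longrightarrow> u \<in> N (\<mu>(i := \<kappa> i)) \<Longrightarrow> f (F a b c u) \<in> N' \<nu>" for f \<mu> \<nu> w
  proof -
    have "subspace {u. f u \<in> N' \<nu>}"
      using Vector_Spaces.linear.axioms(3)[OF f] module_hom.subspace_vimage[of scl scl f "N' \<nu>"]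
      by (simp add: vimage_def N'_def subspace_span)
    moreover have "G \<mu> \<subseteq> {u. f u \<in> N' \<nu>}" using g by (auto simp: G_def)
    ultimately show ?thesis using w span_minimal[of "G \<mu>"] unfolding N'_def by blast
  qed
  have F_mem: "F a b c u \<in> N' \<mu>" if "(a, b) \<in> R \<mu>" "u \<in> N (\<mu>(i := \<kappa> i))" for a b c u \<mu>
    unfolding N'_def by (rule span_base) (use that in \<open>auto simp: G_def\<close>)
  have op_F: "P j (F a b c u) = F a b c (P j u)" if P: "P \<in> {X, Y, H}" and j: "j \<noteq> i" for P j a b c u
  proof -
    have "P j ((X i ^^ a) w) = (X i ^^ a) (P j w)" for w
      by (induction a) (simp_all add: op_commute[OF P _ j])
    moreover have "P j ((Y i ^^ b) w) = (Y i ^^ b) (P j w)" for w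
      by (induction b) (simp_all add: op_commute[OF P _ j])
    moreover have "P j (h w) = h (P j w)" for w
      using Vector_Spaces.linear.axioms(3)[OF linear_op[OF P, of j]] op_commute[OF P _ j, of H]
      by (simp add: h_def module_hom.diff module_hom.scale)
    then have "P j ((h ^^ c) w) = (h ^^ c) (P j w)" for w
      by (induction c) simp_all
    ultimately show ?thesis by (simp add: F_def)
  qed
  \<comment> \<open>Moving H_i to the right past X^a adds a, past Y^b subtracts b, and on the vector
    it is h + \<kappa>_i; the scalars add up to \<mu>_i.\<close>
  have H_F: "H i (F a b c u) = F a b (Suc c) u + scl (\<mu> i) (F a b c u)" if "(a, b) \<in> R \<mu>" for a b c u \<mu>
  proof -
    have HYb: "H i ((Y i ^^ b) w) = (Y i ^^ b) (H i w) - scl (of_nat b) ((Y i ^^ b) w)" for w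
      by (induction b) (simp_all add: HY Y.diff Y.scale scale_left_distrib)
    have HXa: "H i ((X i ^^ a) w) = (X i ^^ a) (H i w) + scl (of_nat a) ((X i ^^ a) w)" for w
      by (induction a) (simp_all add: HX X.add X.scale scale_left_distrib)
    define w where "w = (h ^^ c) u"
    have Hw: "H i w = h w + scl (\<kappa> i) w" by (simp add: h_def)
    note linX = Vector_Spaces.linear.axioms(3)[OF lin_pow[OF linear_op[of X]]]
    note linY = Vector_Spaces.linear.axioms(3)[OF lin_pow[OF linear_op[of Y]]]
    have \<mu>: "\<mu> i = \<kappa> i + of_nat a - of_nat b" using that by (simp add: R_def eq_diff_eq)
    have "H i (F a b c u) = (X i ^^ a) ((Y i ^^ b) (h w)) + scl (\<mu> i) (F a b c u)"
      unfolding F_def w_def[symmetric] \<mu> HXa HYb Hw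
      by (simp add: module_hom.add[OF linX] module_hom.diff[OF linX] module_hom.scale[OF linX]
          module_hom.add[OF linY] module_hom.scale[OF linY] scale_left_distrib scale_left_diff_distrib)
    then show ?thesis by (simp add: F_def w_def)
  qed
  have opN': "X j w \<in> N' (\<mu>(j := \<mu> j + 1)) \<and> Y j w \<in> N' (\<mu>(j := \<mu> j - 1)) \<and> H j w \<in> N' \<mu>"
    if w: "w \<in> N' \<mu>" and j: "j \<in> insert i T" for w \<mu> j
  proof (cases "j = i")
    case False
    then have T: "j \<in> T" using j by simp
    have R: "R (\<mu>(j := x)) = R \<mu>" for x using False by (simp add: R_def)
    have tw: "\<mu>(j := x, i := \<kappa> i) = \<mu>(i := \<kappa> i, j := x)" for x using False by (simp add: fun_upd_twist)
    have op: "P j w \<in> N' (\<mu>(j := x))"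
      if P: "P \<in> {X, Y, H}" and x: "\<And>u. u \<in> N (\<mu>(i := \<kappa> i)) \<Longrightarrow> P j u \<in> N (\<mu>(i := \<kappa> i, j := x))" for P x
    proof (rule span_image_sub[OF linear_op[OF P] w])
      fix a b c u assume ab: "(a, b) \<in> R \<mu>" and u: "u \<in> N (\<mu>(i := \<kappa> i))"
      have "F a b c (P j u) \<in> N' (\<mu>(j := x))"
        by (rule F_mem) (use ab x[OF u] in \<open>simp_all only: R tw\<close>)
      then show "P j (F a b c u) \<in> N' (\<mu>(j := x))" by (simp only: op_F[OF P False])
    qed
    have \<mu>j: "(\<mu>(i := \<kappa> i)) j = \<mu> j" using False by simp
    have "H j w \<in> N' (\<mu>(j := \<mu> j))"
      by (rule op) (use opN[OF T] False in \<open>simp_all add: fun_upd_idem\<close>)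
    moreover have "X j w \<in> N' (\<mu>(j := \<mu> j + 1))" "Y j w \<in> N' (\<mu>(j := \<mu> j - 1))"
      by (rule op; use opN[OF T, of _ "\<mu>(i := \<kappa> i)", unfolded \<mu>j] in blast)+
    ultimately show ?thesis by simp
  next
    case True
    have "X i w \<in> N' (\<mu>(i := \<mu> i + 1))"
    proof (rule span_image_sub[OF linear_op w])
      fix a b c u assume "(a, b) \<in> R \<mu>" "u \<in> N (\<mu>(i := \<kappa> i))"
      then have "F (Suc a) b c u \<in> N' (\<mu>(i := \<mu> i + 1))"
        by (intro F_mem) (auto simp: R_def algebra_simps)
      then show "X i (F a b c u) \<in> N' (\<mu>(i := \<mu> i + 1))" by (simp add: F_def)
    qed simp
    moreover have "Y i w \<in> N' (\<mu>(i := \<mu> i - 1))"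
    proof (rule span_image_sub[OF linear_op w])
      fix a b c u assume ab: "(a, b) \<in> R \<mu>" and u: "u \<in> N (\<mu>(i := \<kappa> i))"
      show "Y i (F a b c u) \<in> N' (\<mu>(i := \<mu> i - 1))"
      \<comment> \<open>\<open>Y i\<close> cancels a leading \<open>X i\<close> by
        \<open>YX\<close>; if there is none, it lengthens the power of \<open>Y i\<close>.\<close>
      proof (cases a)
        case 0
        then have "F 0 (Suc b) c u \<in> N' (\<mu>(i := \<mu> i - 1))"
          using ab u by (intro F_mem) (auto simp: R_def algebra_simps)
        then show ?thesis by (simp add: F_def 0)
      next
        case (Suc a')
        then have "F a' b c u \<in> N' (\<mu>(i := \<mu> i - 1))"
          using ab u by (intro F_mem) (auto simp: R_def algebra_simps)
        then show ?thesis by (simp add: F_def Suc YX)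
      qed
    qed simp
    moreover have "H i w \<in> N' \<mu>"
    proof (rule span_image_sub[OF linear_op w])
      fix a b c u assume ab: "(a, b) \<in> R \<mu>" and u: "u \<in> N (\<mu>(i := \<kappa> i))"
      then show "H i (F a b c u) \<in> N' \<mu>"
        unfolding H_F[OF ab] using F_mem[OF ab u] unfolding N'_def
        by (intro span_add span_scale)
    qed simp
    ultimately show ?thesis using True by simp
  qed
  have suppN': "if j \<in> insert i T then \<exists>z. \<mu> j = \<kappa> j + of_int z else \<mu> j = \<kappa> j"
    if ne: "N' \<mu> \<noteq> {0}" for \<mu> j
  proof -
    have "\<not> G \<mu> \<subseteq> {0}"
    proof
      assume "G \<mu> \<subseteq> {0}"
      then have "N' \<mu> \<subseteq> {0}" unfolding N'_def by (intro span_minimal) (auto simp: subspace_def)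
      then show False using ne span_zero unfolding N'_def by blast
    qed
    \<comment> \<open>A nonzero word forces a nonzero vector of \<open>N\<close> at the weight with
      i-th coordinate reset to \<kappa>_i, where the support condition of \<open>N\<close>
      applies.\<close>
    then obtain a b c u where ab: "(a, b) \<in> R \<mu>" and u: "u \<in> N (\<mu>(i := \<kappa> i))" "F a b c u \<noteq> 0"
      unfolding G_def by blast
    have "u \<noteq> 0" using u(2) lin_0[OF lin_F] by blast
    then have "N (\<mu>(i := \<kappa> i)) \<noteq> {0}" using u(1) by blast
    note s = suppN[OF this, of j]
    show ?thesis
    proof (cases "j = i")
      case True
      have "\<mu> i = \<kappa> i + of_int (int a - int b)" using ab by (simp add: R_def add_diff_eq eq_diff_eq)
      then have "\<exists>z. \<mu> i = \<kappa> i + of_int z" by (rule exI)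
      then show ?thesis using True by simp
    next
      case False
      then show ?thesis using s by (simp split: if_splits)
    qed
  qed
  have "v = F 0 0 0 v" by (simp add: F_def)
  also have "\<dots> \<in> N' \<kappa>" by (rule F_mem) (use v in \<open>auto simp: R_def\<close>)
  finally have "v \<in> N' \<kappa>" .
  moreover have "partial_submodule \<kappa> (insert i T) N'"
    unfolding partial_submodule_def
  proof (intro conjI allI ballI impI)
    show "subspace (N' \<mu>)" for \<mu> unfolding N'_def by (rule subspace_span)
    show "N' \<mu> \<subseteq> M \<mu>" "\<exists>C. finite C \<and> N' \<mu> \<subseteq> span C" for \<mu> by (rule N'M, rule fdN')
    fix \<mu> j u assume j: "j \<in> insert i T" and u: "u \<in> N' \<mu>"
    from opN'[OF u j] show "X j u \<in> N' (\<mu>(j := \<mu> j + 1))" "Y j u \<in> N' (\<mu>(j := \<mu> j - 1))" "H j u \<in> N' \<mu>"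
      by simp_all
  qed (rule suppN')
  ultimately show ?thesis by blast
qed

text \<open>The span of v placed at \<kappa> is stable in no prescribed direction; directions are
  then added one by one. Taking all of them yields a graded stable subspace containing v.\<close>

lemma partial_submodule_exists:
  assumes v: "v \<in> M \<kappa>" and "finite T"
  shows "\<exists>N. partial_submodule \<kappa> T N \<and> v \<in> N \<kappa>"
  using assms(2)
proof (induction T)
  case empty
  let ?N = "\<lambda>\<mu>. if \<mu> = \<kappa> then span {v} else {0}"
  have "span {v} \<subseteq> M \<kappa>" by (rule span_minimal) (use v subspace_M in auto)
  moreover have "0 \<in> M \<mu>" for \<mu> by (rule subspace_0[OF subspace_M])
  ultimately have "partial_submodule \<kappa> {} ?N"
    unfolding partial_submodule_def
    by (auto simp: subspace_def span_zero span_add span_scale intro: exI[of _ "{v}"] exI[of _ "{}"])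
  moreover have "v \<in> ?N \<kappa>" by (simp add: span_base)
  ultimately show ?case by blast
next
  case (insert i T)
  then show ?case using partial_submodule_insert by blast
qed

text \<open>Each weight component of a generator lies in a graded stable subspace with
  finite-dimensional components. The sum of these is the whole space, and uniqueness of weight
  decompositions identifies each \<open>M \<mu>\<close> with the part of the sum in degree
  \<mu>.\<close>

lemma supp_subset_and_finite_dim:
  assumes "finite S" and gen: "\<And>N. stable N \<Longrightarrow> S \<subseteq> N \<Longrightarrow> N = UNIV"
  obtains L where "finite L" "\<And>\<mu>. M \<mu> \<noteq> {0} \<Longrightarrow> \<exists>\<kappa>\<in>L. \<mu> \<in> translation_orbit \<kappa>"
    and "\<And>\<mu>. \<exists>C. finite C \<and> M \<mu> \<subseteq> span C"
proof -
  have "\<forall>v. \<exists>f. (\<forall>i. f i \<in> M i) \<and> finite {i. f i \<noteq> 0} \<and> v = (\<Sum>i | f i \<noteq> 0. f i)"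
    using decomposition unfolding direct_sum_decomposition_def by blast
  then obtain f where f: "\<And>v i. f v i \<in> M i" "\<And>v. finite {i. f v i \<noteq> 0}"
    "\<And>v. v = (\<Sum>i | f v i \<noteq> 0. f v i)" by metis
  \<comment> \<open>Pairs of a generator and a weight at which its component is nonzero.\<close>
  define I where "I = Sigma S (\<lambda>s. {i. f s i \<noteq> 0})"
  have finI: "finite I" unfolding I_def using assms(1) f(2) by blast
  have "\<forall>p. \<exists>N. partial_submodule (snd p) UNIV N \<and> f (fst p) (snd p) \<in> N (snd p)"
    using partial_submodule_exists[OF f(1) finite_UNIV] by blast
  then obtain N where N: "\<And>p. partial_submodule (snd p) UNIV (N p)"
    "\<And>p. f (fst p) (snd p) \<in> N p (snd p)" by metis
  define U where "U \<mu> = span (\<Union>p\<in>I. N p \<mu>)" for \<mu>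
  have UM: "U \<mu> \<subseteq> M \<mu>" for \<mu>
  proof -
    have "N p \<mu> \<subseteq> M \<mu>" for p using N(1)[of p] unfolding partial_submodule_def by blast
    then show ?thesis unfolding U_def by (intro span_minimal[OF _ subspace_M]) blast
  qed
  \<comment> \<open>The pair (P, \<delta>) treats the three operators and their shifts at
    once.\<close>
  have opU: "P i w \<in> U (\<mu>(i := \<mu> i + \<delta>))" if w: "w \<in> U \<mu>" and P: "(P, \<delta>) \<in> {(X, 1), (Y, -1), (H, 0)}" for P i w \<mu> and \<delta> :: 'k
  proof -
    have lin: "Vector_Spaces.linear scl scl (P i)" using P by (auto intro: linear_op)
    have "subspace {u. P i u \<in> U (\<mu>(i := \<mu> i + \<delta>))}"
      using Vector_Spaces.linear.axioms(3)[OF lin] module_hom.subspace_vimage[of scl scl "P i" "U (\<mu>(i := \<mu> i + \<delta>))"]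
      by (simp add: vimage_def U_def subspace_span)
    moreover have "P i u \<in> N p (\<mu>(i := \<mu> i + \<delta>))" if "u \<in> N p \<mu>" for p u
      using that P N(1)[of p] by (auto simp: partial_submodule_def)
    then have "(\<Union>p\<in>I. N p \<mu>) \<subseteq> {u. P i u \<in> U (\<mu>(i := \<mu> i + \<delta>))}"
      unfolding U_def by (auto intro!: span_base)
    ultimately show ?thesis using w span_minimal[of "\<Union>p\<in>I. N p \<mu>"] unfolding U_def by blast
  qed
  define V where "V = span (\<Union>\<mu>. U \<mu>)"
  have opV: "P i w \<in> V" if w: "w \<in> V" and P: "(P, \<delta>) \<in> {(X, 1), (Y, -1), (H, 0)}" for P i w and \<delta> :: 'k
  proof -
    have lin: "Vector_Spaces.linear scl scl (P i)" using P by (auto intro: linear_op)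
    have "subspace {u. P i u \<in> V}"
      using Vector_Spaces.linear.axioms(3)[OF lin] module_hom.subspace_vimage[of scl scl "P i" V]
      by (simp add: vimage_def V_def subspace_span)
    moreover have "(\<Union>\<mu>. U \<mu>) \<subseteq> {u. P i u \<in> V}"
      unfolding V_def using opU[OF _ P] by (blast intro!: span_base)
    ultimately show ?thesis using w span_minimal[of "\<Union>\<mu>. U \<mu>"] unfolding V_def by blast
  qed
  have "stable V"
    unfolding stable_def using opV[where P = X and \<delta> = 1] opV[where P = Y and \<delta> = "- 1"]
      opV[where P = H and \<delta> = 0] subspace_span[of "\<Union>\<mu>. U \<mu>", folded V_def] by blast
  moreover have "S \<subseteq> V"
  proof
    fix s assume s: "s \<in> S"
    have "f s i \<in> V" if "f s i \<noteq> 0" for i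
    proof -
      have "(s, i) \<in> I" using s that by (simp add: I_def)
      then have "f s i \<in> U i" unfolding U_def using N(2)[of "(s, i)"] by (auto intro!: span_base)
      then show ?thesis unfolding V_def by (auto intro!: span_base)
    qed
    then have "(\<Sum>i | f s i \<noteq> 0. f s i) \<in> V" unfolding V_def by (intro span_sum) auto
    then show "s \<in> V" using f(3) by metis
  qed
  ultimately have V: "V = UNIV" by (rule gen)
  \<comment> \<open>To pass from the ungraded equality \<open>V = UNIV\<close> to each weight, every
    vector is written as a finite sum with components in the \<open>U \<nu>\<close>.\<close>
  have MU: "M \<mu> \<subseteq> U \<mu>" for \<mu>
  proof
    fix v assume v: "v \<in> M \<mu>"
    have U0: "0 \<in> U \<nu>" for \<nu> by (simp add: U_def span_zero)
    define good where "good w \<longleftrightarrow> (\<exists>g. (\<forall>i. g i \<in> U i) \<and> finite {i. g i \<noteq> 0} \<and> w = (\<Sum>i | g i \<noteq> 0. g i))" for w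
    have "subspace {w. good w}"
    proof (rule subspaceI)
      show "0 \<in> {w. good w}" unfolding good_def using U0 by (auto intro!: exI[of _ "\<lambda>_. 0"])
    next
      fix x y assume "x \<in> {w. good w}" "y \<in> {w. good w}"
      then obtain g g' where g: "\<forall>i. g i \<in> U i" "finite {i. g i \<noteq> 0}" "x = (\<Sum>i | g i \<noteq> 0. g i)"
        and g': "\<forall>i. g' i \<in> U i" "finite {i. g' i \<noteq> 0}" "y = (\<Sum>i | g' i \<noteq> 0. g' i)"
        unfolding good_def by blast
      let ?A = "{i. g i \<noteq> 0} \<union> {i. g' i \<noteq> 0}"
      have fin: "finite ?A" using g g' by simp
      have sub: "{i. g i + g' i \<noteq> 0} \<subseteq> ?A" by auto
      have "x + y = (\<Sum>i\<in>?A. g i) + (\<Sum>i\<in>?A. g' i)"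
        unfolding g(3) g'(3) using fin by (intro arg_cong2[of _ _ _ _ plus] sum.mono_neutral_left) auto
      also have "\<dots> = (\<Sum>i | g i + g' i \<noteq> 0. g i + g' i)"
        unfolding sum.distrib[symmetric] by (rule sum.mono_neutral_right[OF fin sub]) auto
      finally have "x + y = (\<Sum>i | g i + g' i \<noteq> 0. g i + g' i)" .
      moreover have "\<forall>i. g i + g' i \<in> U i" using g g' by (simp add: U_def span_add)
      ultimately show "x + y \<in> {w. good w}"
        unfolding good_def using finite_subset[OF sub fin] by (auto intro!: exI[of _ "\<lambda>i. g i + g' i"])
    next
      fix c x assume "x \<in> {w. good w}"
      then obtain g where g: "\<forall>i. g i \<in> U i" "finite {i. g i \<noteq> 0}" "x = (\<Sum>i | g i \<noteq> 0. g i)"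
        unfolding good_def by blast
      have "scl c x = (\<Sum>i | g i \<noteq> 0. scl c (g i))"
        unfolding g(3) by (rule scale_sum_right)
      also have "\<dots> = (\<Sum>i | scl c (g i) \<noteq> 0. scl c (g i))"
        by (rule sum.mono_neutral_right) (use g in auto)
      finally have "scl c x = (\<Sum>i | scl c (g i) \<noteq> 0. scl c (g i))" .
      moreover have "finite {i. scl c (g i) \<noteq> 0}" by (rule finite_subset[OF _ g(2)]) auto
      moreover have "\<forall>i. scl c (g i) \<in> U i" using g by (simp add: U_def span_scale)
      ultimately show "scl c x \<in> {w. good w}"
        unfolding good_def by (auto intro!: exI[of _ "\<lambda>i. scl c (g i)"])
    qed
    moreover have single: "(\<Sum>i | (if i = \<nu> then u else 0) \<noteq> 0. if i = \<nu> then u else 0) = u" for u :: 'm and \<nu> :: "'n \<Rightarrow> 'k"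
    proof -
      have "(\<Sum>i | (if i = \<nu> then u else 0) \<noteq> 0. if i = \<nu> then u else 0) = (\<Sum>i\<in>{\<nu>}. if i = \<nu> then u else 0)"
        by (rule sum.mono_neutral_left) auto
      then show ?thesis by simp
    qed
    have fin1: "finite {i. (if i = \<nu> then u else 0) \<noteq> 0}" for u :: 'm and \<nu> :: "'n \<Rightarrow> 'k"
      by (rule finite_subset[of _ "{\<nu>}"]) auto
    have "(\<Union>\<mu>. U \<mu>) \<subseteq> {w. good w}"
    proof
      fix u assume "u \<in> (\<Union>\<mu>. U \<mu>)"
      then obtain \<nu> where "u \<in> U \<nu>" by blast
      then show "u \<in> {w. good w}"
        unfolding good_def using U0 single[of \<nu> u] fin1[of \<nu> u]
        by (auto intro!: exI[of _ "\<lambda>i. if i = \<nu> then u else 0"])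
    qed
    ultimately have "V \<subseteq> {w. good w}" unfolding V_def by (intro span_minimal)
    then have "good v" using V by blast
    then obtain g where g: "\<forall>i. g i \<in> U i" "finite {i. g i \<noteq> 0}" "v = (\<Sum>i | g i \<noteq> 0. g i)"
      unfolding good_def by blast
    define dec where
      "dec f \<longleftrightarrow> (\<forall>i. f i \<in> M i) \<and> finite {i. f i \<noteq> 0} \<and> v = (\<Sum>i | f i \<noteq> 0. f i)" for f
    have "\<exists>!f. dec f"
      unfolding dec_def using decomposition[unfolded direct_sum_decomposition_def] by (rule spec)
    moreover have "dec g"
      unfolding dec_def using g UM by blast
    moreover
    \<comment> \<open>A vector of \<open>M \<mu>\<close> is its own decomposition, concentrated at
      \<mu>; uniqueness makes the one with components in \<open>U\<close> agree with it.\<close>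
    let ?g = "\<lambda>i. if i = \<mu> then v else 0"
    have "dec ?g"
      unfolding dec_def using single[of \<mu> v] fin1[of \<mu> v] v subspace_0[OF subspace_M] by simp
    ultimately have "g = ?g" by blast
    then have "g \<mu> = v" by simp
    then show "v \<in> U \<mu>" using g by blast
  qed
  show thesis
  proof (rule that[of "snd ` I"])
    show "finite (snd ` I)" using finI by simp
  next
    fix \<mu> assume "M \<mu> \<noteq> {0}"
    have "\<exists>p\<in>I. N p \<mu> \<noteq> {0}"
    proof (rule ccontr)
      assume "\<not> ?thesis"
      then have "U \<mu> \<subseteq> {0}" unfolding U_def by (intro span_minimal) (auto simp: subspace_def)
      then have "M \<mu> \<subseteq> {0}" using MU by blast
      then show False using \<open>M \<mu> \<noteq> {0}\<close> subspace_0[OF subspace_M] by blast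
    qed
    then obtain p where p: "p \<in> I" "N p \<mu> \<noteq> {0}" by blast
    then have "\<forall>j. \<exists>z. \<mu> j = snd p j + of_int z"
      using N(1)[of p] by (auto simp: partial_submodule_def)
    then obtain z where "\<And>j. \<mu> j = snd p j + of_int (z j)" by metis
    then have "\<mu> = (\<lambda>j. snd p j + of_int (z j))" by blast
    then have "\<mu> \<in> translation_orbit (snd p)" unfolding translation_orbit_def by blast
    then show "\<exists>\<kappa>\<in>snd ` I. \<mu> \<in> translation_orbit \<kappa>" using p by blast
  next
    fix \<mu>
    have "\<forall>p. \<exists>C. finite C \<and> N p \<mu> \<subseteq> span C" using N(1) by (auto simp: partial_submodule_def)
    then obtain C where C: "\<And>p. finite (C p)" "\<And>p. N p \<mu> \<subseteq> span (C p)" by metis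
    have "(\<Union>p\<in>I. N p \<mu>) \<subseteq> span (\<Union>p\<in>I. C p)"
    proof
      fix u assume "u \<in> (\<Union>p\<in>I. N p \<mu>)"
      then obtain p where "p \<in> I" "u \<in> span (C p)" using C by blast
      then show "u \<in> span (\<Union>p\<in>I. C p)" using span_mono[of "C p" "\<Union>p\<in>I. C p"] by blast
    qed
    then have "U \<mu> \<subseteq> span (\<Union>p\<in>I. C p)" unfolding U_def by (intro span_minimal subspace_span)
    with MU[of \<mu>] have "M \<mu> \<subseteq> span (\<Union>p\<in>I. C p)" by (rule subset_trans)
    moreover have "finite (\<Union>p\<in>I. C p)" using finI C(1) by (rule finite_UN_I)
    ultimately show "\<exists>C. finite C \<and> M \<mu> \<subseteq> span C" by blast
  qed
qed

section \<open>The equivalence for abstract weight decompositions\<close>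

theorem generated_iff:
  "(\<exists>S. finite S \<and> (\<forall>N. stable N \<and> S \<subseteq> N \<longrightarrow> N = UNIV)) \<longleftrightarrow>
    (\<exists>Orbs. finite Orbs \<and> Orbs \<subseteq> range translation_orbit \<and> {\<mu>. M \<mu> \<noteq> {0}} \<subseteq> \<Union>Orbs) \<and>
    (\<exists>d. \<forall>\<mu>. dim_at_most scl (M \<mu>) d)"
proof (intro iffI)
  assume "\<exists>S. finite S \<and> (\<forall>N. stable N \<and> S \<subseteq> N \<longrightarrow> N = UNIV)"
  then obtain S where "finite S" "\<And>N. stable N \<Longrightarrow> S \<subseteq> N \<Longrightarrow> N = UNIV" by blast
  then obtain L where L: "finite L" "\<And>\<mu>. M \<mu> \<noteq> {0} \<Longrightarrow> \<exists>\<kappa>\<in>L. \<mu> \<in> translation_orbit \<kappa>"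
    and fd: "\<And>\<mu>. \<exists>C. finite C \<and> M \<mu> \<subseteq> span C"
    by (rule supp_subset_and_finite_dim) blast+
  \<comment> \<open>Finite dimension becomes a uniform bound along an orbit, since every component
    is an image of the one at the representative.\<close>
  have "\<forall>\<kappa>. \<exists>d. \<forall>\<mu>\<in>translation_orbit \<kappa>. dim_at_most scl (M \<mu>) d"
  proof
    fix \<kappa>0 :: "'n \<Rightarrow> 'k"
    obtain \<kappa> where \<kappa>: "\<And>i k. \<kappa> i \<noteq> - of_nat k"
      "\<And>\<nu>. \<nu> \<in> translation_orbit \<kappa>0 \<Longrightarrow> \<exists>z. \<nu> = (\<lambda>i. \<kappa> i + of_int (z i))"
      using orbit_representative[of \<kappa>0] by blast
    obtain C where C: "finite C" "M \<kappa> \<subseteq> span C" using fd by blast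
    have base: "dim_at_most scl (M \<kappa>) (card C)"
      by (rule dim_at_mostI[OF vector_space_axioms subspace_M C order_refl])
    have "dim_at_most scl (M (\<lambda>j. \<kappa> j + of_int (z j))) (card C)" for z
      by (rule orbit_induct[where Q = "\<lambda>V. dim_at_most scl V (card C)", OF base _ _ \<kappa>(1)])
        (auto intro!: dim_at_most_image linear_op)
    with \<kappa>(2) show "\<exists>d. \<forall>\<mu>\<in>translation_orbit \<kappa>0. dim_at_most scl (M \<mu>) d" by metis
  qed
  then obtain d where d: "\<And>\<kappa> \<mu>. \<mu> \<in> translation_orbit \<kappa> \<Longrightarrow> dim_at_most scl (M \<mu>) (d \<kappa>)" by metis
  \<comment> \<open>The sum dominates the bound of each of the finitely many orbits, and also covers
    an empty \<open>L\<close>.\<close>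
  have "dim_at_most scl (M \<mu>) (sum d L)" for \<mu>
  proof (cases "M \<mu> = {0}")
    case True
    then show ?thesis
      using dim_at_mostI[OF vector_space_axioms subspace_M, of "{}" \<mu>] by simp
  next
    case False
    then obtain \<kappa> where \<kappa>: "\<kappa> \<in> L" "\<mu> \<in> translation_orbit \<kappa>" using L by blast
    have "d \<kappa> \<le> sum d L" using \<kappa> L(1) by (simp add: member_le_sum)
    then show ?thesis using d[OF \<kappa>(2)] by (auto simp: dim_at_most_def)
  qed
  moreover have "finite (translation_orbit ` L)" "translation_orbit ` L \<subseteq> range translation_orbit"
    "{\<mu>. M \<mu> \<noteq> {0}} \<subseteq> \<Union>(translation_orbit ` L)" using L by auto
  ultimately show "(\<exists>Orbs. finite Orbs \<and> Orbs \<subseteq> range translation_orbit \<and> {\<mu>. M \<mu> \<noteq> {0}} \<subseteq> \<Union>Orbs) \<and>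
    (\<exists>d. \<forall>\<mu>. dim_at_most scl (M \<mu>) d)" by blast
next
  assume "(\<exists>Orbs. finite Orbs \<and> Orbs \<subseteq> range translation_orbit \<and> {\<mu>. M \<mu> \<noteq> {0}} \<subseteq> \<Union>Orbs) \<and>
    (\<exists>d. \<forall>\<mu>. dim_at_most scl (M \<mu>) d)"
  then obtain Orbs d where Orbs: "finite Orbs" "Orbs \<subseteq> range translation_orbit" "{\<mu>. M \<mu> \<noteq> {0}} \<subseteq> \<Union>Orbs"
    and d: "\<And>\<mu>. dim_at_most scl (M \<mu>) d" by blast
  have "\<forall>Ob\<in>Orbs. \<exists>\<kappa>. (\<forall>i k. \<kappa> i \<noteq> - of_nat k) \<and> (\<forall>\<nu>\<in>Ob. \<exists>z. \<nu> = (\<lambda>i. \<kappa> i + of_int (z i)))"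
  proof
    fix Ob assume "Ob \<in> Orbs"
    then obtain \<mu> where "Ob = translation_orbit \<mu>" using Orbs by blast
    then show "\<exists>\<kappa>. (\<forall>i k. \<kappa> i \<noteq> - of_nat k) \<and> (\<forall>\<nu>\<in>Ob. \<exists>z. \<nu> = (\<lambda>i. \<kappa> i + of_int (z i)))"
      using orbit_representative[of \<mu>] by metis
  qed
  then obtain \<kappa> where \<kappa>: "\<And>Ob i k. Ob \<in> Orbs \<Longrightarrow> \<kappa> Ob i \<noteq> - of_nat k"
    "\<And>Ob \<nu>. Ob \<in> Orbs \<Longrightarrow> \<nu> \<in> Ob \<Longrightarrow> \<exists>z. \<nu> = (\<lambda>i. \<kappa> Ob i + of_int (z i))" by metis
  have "\<forall>\<mu>. \<exists>B. finite B \<and> span B = M \<mu>" using d unfolding dim_at_most_def by blast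
  then obtain B where B: "\<And>\<mu>. finite (B \<mu>)" "\<And>\<mu>. span (B \<mu>) = M \<mu>" by metis
  show "\<exists>S. finite S \<and> (\<forall>N. stable N \<and> S \<subseteq> N \<longrightarrow> N = UNIV)"
  proof (intro exI conjI allI impI)
    \<comment> \<open>The generators span one component per orbit, at the representative from which
      all the others are reached.\<close>
    show "finite (\<Union>Ob\<in>Orbs. B (\<kappa> Ob))" using Orbs B by blast
    fix N assume N: "stable N \<and> (\<Union>Ob\<in>Orbs. B (\<kappa> Ob)) \<subseteq> N"
    then have subN: "subspace N" and opN: "\<And>i v. v \<in> N \<Longrightarrow> X i v \<in> N" "\<And>i v. v \<in> N \<Longrightarrow> Y i v \<in> N"
      unfolding stable_def by blast+
    have MN: "M \<mu> \<subseteq> N" for \<mu>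
    proof (cases "M \<mu> = {0}")
      case True
      then show ?thesis using subspace_0[OF subN] by simp
    next
      case False
      then obtain Ob where Ob: "Ob \<in> Orbs" "\<mu> \<in> Ob" using Orbs by blast
      have base: "M (\<kappa> Ob) \<subseteq> N" unfolding B(2)[symmetric]
        by (rule span_minimal[OF _ subN]) (use N Ob in blast)
      have "M (\<lambda>j. \<kappa> Ob j + of_int (z j)) \<subseteq> N" for z
        by (rule orbit_induct[where Q = "\<lambda>V. V \<subseteq> N", OF base _ _ \<kappa>(1)[OF Ob(1)]]) (use opN in auto)
      then show ?thesis using \<kappa>(2)[OF Ob] by metis
    qed
    have "v \<in> N" for v
    proof -
      obtain f where f: "\<And>i. f i \<in> M i" "v = (\<Sum>i | f i \<noteq> 0. f i)"
        using decomposition unfolding direct_sum_decomposition_def by metis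
      show ?thesis unfolding f(2) by (rule subspace_sum[OF subN]) (use f(1) MN in blast)
    qed
    then show "N = UNIV" by blast
  qed
qed

end

section \<open>Modules over the integro-differential algebra\<close>

lemma op_linear_integro_diff: "f \<in> integro_diff_algebra \<Longrightarrow> op_linear f"
  unfolding integro_diff_algebra_def
  by (erule op_linear_generated) (auto intro: op_linear_mult_var op_linear_partial op_linear_integration)

lemma integro_diff_algebra_closed:
  "a \<in> integro_diff_algebra \<Longrightarrow> b \<in> integro_diff_algebra \<Longrightarrow> a \<circ> b \<in> integro_diff_algebra"
  "a \<in> integro_diff_algebra \<Longrightarrow> b \<in> integro_diff_algebra \<Longrightarrow> (\<lambda>p. a p + b p) \<in> integro_diff_algebra"
  unfolding integro_diff_algebra_def
  by (rule generated_subalgebra.comp generated_subalgebra.add; assumption)+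

locale integro_diff_module = left_module integro_diff_algebra act
  for act :: "('k::field_char_0, 'n::finite) mpoly_op \<Rightarrow> 'm::ab_group_add \<Rightarrow> 'm"
begin

section \<open>Vector space structure and weight components of a module\<close>

abbreviation scl :: "'k \<Rightarrow> 'm \<Rightarrow> 'm" where "scl \<equiv> module_scale act"

sublocale vector_space scl
  by (rule vector_space_module_scale[of "range mult_var \<union> range partial \<union> range integration"])
    (unfold integro_diff_algebra_def[symmetric], rule left_module_axioms)

lemma act_linear:
  assumes a: "a \<in> integro_diff_algebra"
  shows "Vector_Spaces.linear scl scl (act a)"
proof unfold_locales
  show "act a (v + w) = act a v + act a w" for v w by (rule act_add_right[OF a])
  show "act a (scl c v) = scl c (act a v)" for c v
  proof -
    have "a \<circ> scalar c = scalar c \<circ> a"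
      using op_linear_integro_diff[OF a] by (simp add: op_linear_def fun_eq_iff)
    then show ?thesis
      unfolding module_scale_def
      using act_comp[OF a integro_diff_algebra_gen(5), of c v] act_comp[OF integro_diff_algebra_gen(5) a, of c v]
      by simp
  qed
qed

lemma act_0: "a \<in> integro_diff_algebra \<Longrightarrow> act a 0 = 0"
  using module_hom.zero[OF Vector_Spaces.linear.axioms(3)[OF act_linear]] .

lemma act_diff_left:
  assumes "a \<in> integro_diff_algebra" "b \<in> integro_diff_algebra"
  shows "(\<lambda>p. a p - b p) \<in> integro_diff_algebra" "act (\<lambda>p. a p - b p) v = act a v - act b v"
proof -
  have eq: "(\<lambda>p. a p - b p) = (\<lambda>p. a p + (scalar (- 1) \<circ> b) p)"
    by (simp add: fun_eq_iff scalar_def single_uminus)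
  have b': "scalar (- 1) \<circ> b \<in> integro_diff_algebra"
    by (intro integro_diff_algebra_closed integro_diff_algebra_gen assms)
  show "(\<lambda>p. a p - b p) \<in> integro_diff_algebra"
    unfolding eq by (intro integro_diff_algebra_closed assms b')
  have "act (scalar (- 1) \<circ> b) v = scl (- 1) (act b v)"
    unfolding module_scale_def by (rule act_comp[OF integro_diff_algebra_gen(5) assms(2)])
  then show "act (\<lambda>p. a p - b p) v = act a v - act b v"
    unfolding eq act_add_left[OF assms(1) b'] by simp
qed

text \<open>An element a of the ideal power at the target passes Z as a Z = Z a', with a' in the
  same power at the source, which kills v.\<close>

lemma act_weight_shift:
  assumes Z: "weight_shift Z \<delta>" "Z \<in> integro_diff_algebra" and v: "v \<in> gen_weight_component act \<mu>"
  shows "act Z v \<in> gen_weight_component act (\<lambda>j. \<mu> j + \<delta> j)"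
proof -
  obtain k where k: "\<And>a. a \<in> ideal_power D_algebra (max_ideal \<mu>) k \<Longrightarrow> act a v = 0"
    using v unfolding gen_weight_component_def by blast
  have "act a (act Z v) = 0" if a: "a \<in> ideal_power D_algebra (max_ideal (\<lambda>j. \<mu> j + \<delta> j)) k" for a
  proof -
    obtain a' where a': "a' \<in> ideal_power D_algebra (max_ideal \<mu>) k" "a \<circ> Z = Z \<circ> a'"
      using weight_shift_ideal_power[OF Z(1) a] by blast
    have A: "a \<in> integro_diff_algebra" "a' \<in> integro_diff_algebra"
      using a a'(1) ideal_power_subset D_algebra_subset by blast+
    have "act a (act Z v) = act Z (act a' v)"
      using act_comp[OF A(1) Z(2), of v] act_comp[OF Z(2) A(2), of v] a'(2) by simp
    then show ?thesis using k[OF a'(1)] act_0[OF Z(2)] by simp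
  qed
  then show ?thesis unfolding gen_weight_component_def by blast
qed

lemma subspace_gen_weight_component: "subspace (gen_weight_component act \<mu>)"
proof (rule subspaceI)
  have A: "a \<in> integro_diff_algebra" if "a \<in> ideal_power D_algebra (max_ideal \<mu>) k" for a k
    using that ideal_power_subset D_algebra_subset by blast
  show "0 \<in> gen_weight_component act \<mu>"
    unfolding gen_weight_component_def using act_0[OF A] by blast
  fix v w assume "v \<in> gen_weight_component act \<mu>" "w \<in> gen_weight_component act \<mu>"
  then obtain k l where k: "\<And>a. a \<in> ideal_power D_algebra (max_ideal \<mu>) k \<Longrightarrow> act a v = 0"
    and l: "\<And>a. a \<in> ideal_power D_algebra (max_ideal \<mu>) l \<Longrightarrow> act a w = 0"
    unfolding gen_weight_component_def by blast
  \<comment> \<open>The larger of the two exponents serves both vectors.\<close>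
  have "act a (v + w) = 0" if a: "a \<in> ideal_power D_algebra (max_ideal \<mu>) (max k l)" for a
  proof -
    have "a \<in> ideal_power D_algebra (max_ideal \<mu>) k" "a \<in> ideal_power D_algebra (max_ideal \<mu>) l"
      using a ideal_power_antimono[of k "max k l" \<mu>] ideal_power_antimono[of l "max k l" \<mu>] by auto
    then show ?thesis using k l act_add_right[OF A[OF a]] by simp
  qed
  then show "v + w \<in> gen_weight_component act \<mu>" unfolding gen_weight_component_def by blast
next
  fix c v assume "v \<in> gen_weight_component act \<mu>"
  from act_weight_shift[OF weight_shift_scalar integro_diff_algebra_gen(5) this, of c]
  show "scl c v \<in> gen_weight_component act \<mu>" by (simp add: module_scale_def)
qed

lemma gen_weight_component_nilpotent:
  assumes "v \<in> gen_weight_component act \<mu>"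
  shows "\<exists>k. ((\<lambda>w. act (H_op i) w - scl (\<mu> i) w) ^^ k) v = 0"
proof -
  let ?t = "\<lambda>p. H_op i p - scalar (\<mu> i) p"
  have t: "?t \<in> integro_diff_algebra" "act ?t = (\<lambda>w. act (H_op i) w - scl (\<mu> i) w)"
    using act_diff_left[OF integro_diff_algebra_gen(4,5)] by (auto simp: module_scale_def)
  \<comment> \<open>The action respects composition only inside the algebra, so membership is
    carried along.\<close>
  have "?t ^^ k \<in> integro_diff_algebra \<and> act (?t ^^ k) v = (act ?t ^^ k) v" for k
  proof (induction k)
    case 0
    then show ?case using integro_diff_algebra_gen(6) act_id by (simp add: id_def)
  next
    case (Suc k)
    then have IH: "?t ^^ k \<in> integro_diff_algebra" "act (?t ^^ k) v = (act ?t ^^ k) v" by blast+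
    have "act (?t \<circ> ?t ^^ k) v = (act ?t \<circ> act ?t ^^ k) v"
      using act_comp[OF t(1) IH(1), of v] unfolding IH(2) o_apply[of "act ?t"] .
    then show ?case
      using integro_diff_algebra_closed(1)[OF t(1) IH(1)] unfolding funpow.simps by (rule conjI[rotated])
  qed
  moreover obtain k where k: "\<And>a. a \<in> ideal_power D_algebra (max_ideal \<mu>) k \<Longrightarrow> act a v = 0"
    using assms unfolding gen_weight_component_def by blast
  have "act (?t ^^ k) v = 0" by (rule k[OF power_in_ideal_power])
  ultimately have "(act ?t ^^ k) v = 0" by simp
  then show ?thesis unfolding t(2) by (rule exI)
qed

lemma weight_decomposition:
  assumes "direct_sum_decomposition (gen_weight_component act)"
  shows "weight_decomposition scl (\<lambda>i. act (integration i)) (\<lambda>i. act (partial i)) (\<lambda>i. act (H_op i))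
    (gen_weight_component act)"
proof (intro weight_decomposition.intro weight_decomposition_axioms.intro)
  note A = integro_diff_algebra_gen
  note comp = act_comp[symmetric]
  fix i :: 'n and v :: 'm and \<mu>
  show "Vector_Spaces.linear scl scl (P i)"
    if "P \<in> {\<lambda>i. act (integration i), \<lambda>i. act (partial i), \<lambda>i. act (H_op i)}" for P
    using that by (auto intro!: act_linear A)
  show "P i (Q j v) = Q j (P i v)"
    if "P \<in> {\<lambda>i. act (integration i), \<lambda>i. act (partial i), \<lambda>i. act (H_op i)}"
      "Q \<in> {\<lambda>i. act (integration i), \<lambda>i. act (partial i), \<lambda>i. act (H_op i)}" "i \<noteq> j" for P Q j
  proof -
    obtain P' Q' where "P' \<in> {integration, partial, H_op}" "P = (\<lambda>i. act (P' i))"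
      "Q' \<in> {integration, partial, H_op}" "Q = (\<lambda>i. act (Q' i))"
      using \<open>P \<in> _\<close> \<open>Q \<in> _\<close> by blast
    moreover from this have "P' i \<in> integro_diff_algebra" "Q' j \<in> integro_diff_algebra"
      using A by auto
    ultimately show ?thesis using ops_commute[OF \<open>i \<noteq> j\<close>, of P' Q'] by (simp add: comp)
  qed
  show "act (partial i) (act (integration i) v) = v"
    by (simp add: comp A partial_integration act_id)
  have IH: "integration i \<circ> H_op i \<in> integro_diff_algebra" "partial i \<circ> H_op i \<in> integro_diff_algebra"
    "integration i \<circ> partial i \<in> integro_diff_algebra"
    "integration i \<circ> partial i \<circ> H_op i \<in> integro_diff_algebra"
    by (intro integro_diff_algebra_closed A)+
  show "act (H_op i) (act (integration i) v) = act (integration i) (act (H_op i) v) + act (integration i) v"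
    using act_add_left[OF IH(1) A(3), of i v] by (simp add: comp A H_integration)
  show "act (H_op i) (act (partial i) v) = act (partial i) (act (H_op i) v) - act (partial i) v"
    using act_diff_left(2)[OF IH(2) A(2), of i v] by (simp add: comp A H_partial)
  \<comment> \<open>Inserting \<open>id\<close> makes the right side a difference of two algebra
    elements, to which \<open>act_diff_left\<close> applies.\<close>
  have "act (\<lambda>p. H_op i p - (integration i \<circ> partial i \<circ> H_op i) p) v =
      act (\<lambda>p. id p - (integration i \<circ> partial i) p) v"
    by (simp only: constant_projection_H id_apply)
  then show "act (H_op i) v - act (integration i) (act (partial i) (act (H_op i) v)) =
      v - act (integration i) (act (partial i) v)"
    unfolding act_diff_left(2)[OF A(4) IH(4)] act_diff_left(2)[OF A(6) IH(3)]
    by (simp only: act_comp[OF IH(3) A(4)] act_comp[OF A(3) A(2)] act_id)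
  show "subspace (gen_weight_component act \<mu>)" by (rule subspace_gen_weight_component)
  have upd: "(\<lambda>j. \<mu> j + (if j = i then c else 0)) = \<mu>(i := \<mu> i + c)" for c
    by (simp add: fun_eq_iff)
  assume v: "v \<in> gen_weight_component act \<mu>"
  show "act (integration i) v \<in> gen_weight_component act (\<mu>(i := \<mu> i + 1))"
    using act_weight_shift[OF weight_shift_integration A(3) v, of i] by (simp only: upd)
  have "act (partial i) v \<in> gen_weight_component act (\<mu>(i := \<mu> i + - 1))"
    using act_weight_shift[OF weight_shift_partial A(2) v, of i] by (simp only: upd)
  then show "act (partial i) v \<in> gen_weight_component act (\<mu>(i := \<mu> i - 1))"
    by (simp only: add_uminus_conv_diff)
  show "act (H_op i) v \<in> gen_weight_component act \<mu>"
    using act_weight_shift[OF weight_shift_H_op A(4) v, of i] by simp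
  show "\<exists>k. ((\<lambda>w. act (H_op i) w - scl (\<mu> i) w) ^^ k) v = 0"
    by (rule gen_weight_component_nilpotent[OF v])
qed (rule vector_space_axioms assms)+

section \<open>Submodules and finite generation\<close>

definition submodule :: "'m set \<Rightarrow> bool" where
  "submodule N \<longleftrightarrow> subspace N \<and> (\<forall>a\<in>integro_diff_algebra. \<forall>v\<in>N. act a v \<in> N)"

lemma submoduleI:
  assumes sub: "subspace N"
    and ops: "\<And>i v. v \<in> N \<Longrightarrow> act (integration i) v \<in> N \<and> act (partial i) v \<in> N \<and> act (H_op i) v \<in> N"
  shows "submodule N"
proof -
  note A = integro_diff_algebra_gen
  \<comment> \<open>Membership belongs to the claim because the laws of the action hold only inside
    the algebra.\<close>
  have "a \<in> integro_diff_algebra \<and> (\<forall>v\<in>N. act a v \<in> N)" if "a \<in> integro_diff_algebra" for a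
    using that[unfolded integro_diff_algebra_def]
  proof induction
    case (gen f)
    have m: "act (mult_var i) v \<in> N" if "v \<in> N" for i v
      unfolding mult_var_eq act_comp[OF A(3) A(4)] using ops that by blast
    from gen obtain i where "f = mult_var i \<or> f = partial i \<or> f = integration i" by blast
    then show ?case by (elim disjE) (simp_all add: ops m A(1-3))
  next
    case one
    show ?case unfolding act_id using A(6) by blast
  next
    case (scale f c)
    then have f: "f \<in> integro_diff_algebra" "\<And>v. v \<in> N \<Longrightarrow> act f v \<in> N" by blast+
    have "act (scalar c \<circ> f) v \<in> N" if "v \<in> N" for v
      unfolding act_comp[OF A(5) f(1)] module_scale_def[of act, symmetric]
      by (rule subspace_scale[OF sub f(2)[OF that]])
    with integro_diff_algebra_closed(1)[OF A(5) f(1)] show ?case by blast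
  next
    case (add f g)
    then have fg: "f \<in> integro_diff_algebra" "g \<in> integro_diff_algebra"
      "\<And>v. v \<in> N \<Longrightarrow> act f v \<in> N" "\<And>v. v \<in> N \<Longrightarrow> act g v \<in> N" by blast+
    have "act (\<lambda>p. f p + g p) v \<in> N" if "v \<in> N" for v
      unfolding act_add_left[OF fg(1,2)] by (rule subspace_add[OF sub fg(3,4)[OF that]])
    with integro_diff_algebra_closed(2)[OF fg(1,2)] show ?case by blast
  next
    case (comp f g)
    then have fg: "f \<in> integro_diff_algebra" "g \<in> integro_diff_algebra"
      "\<And>v. v \<in> N \<Longrightarrow> act f v \<in> N" "\<And>v. v \<in> N \<Longrightarrow> act g v \<in> N" by blast+
    have "act (f \<circ> g) v \<in> N" if "v \<in> N" for v
      unfolding act_comp[OF fg(1,2)] by (rule fg(3)[OF fg(4)[OF that]])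
    with integro_diff_algebra_closed(1)[OF fg(1,2)] show ?case by blast
  qed
  then show ?thesis using sub unfolding submodule_def by blast
qed

text \<open>The sums of terms \<open>act (a s) s\<close> form the least submodule containing
  \<open>S\<close>, so they exhaust the module exactly when no proper submodule contains
  \<open>S\<close>.\<close>

lemma finitely_generated_iff:
  "finitely_generated integro_diff_algebra act \<longleftrightarrow>
    (\<exists>S. finite S \<and> (\<forall>N. submodule N \<and> S \<subseteq> N \<longrightarrow> N = UNIV))"
proof
  assume "finitely_generated integro_diff_algebra act"
  then obtain S where S: "finite S"
    "\<And>v. \<exists>a. (\<forall>s\<in>S. a s \<in> integro_diff_algebra) \<and> v = (\<Sum>s\<in>S. act (a s) s)"
    unfolding finitely_generated_def by blast
  have "N = UNIV" if N: "submodule N" "S \<subseteq> N" for N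
  proof -
    have "v \<in> N" for v
    proof -
      obtain a where a: "\<forall>s\<in>S. a s \<in> integro_diff_algebra" "v = (\<Sum>s\<in>S. act (a s) s)" using S(2) by blast
      show ?thesis unfolding a(2)
        by (rule subspace_sum) (use N a(1) in \<open>auto simp: submodule_def\<close>)
    qed
    then show ?thesis by blast
  qed
  with S(1) show "\<exists>S. finite S \<and> (\<forall>N. submodule N \<and> S \<subseteq> N \<longrightarrow> N = UNIV)" by blast
next
  assume "\<exists>S. finite S \<and> (\<forall>N. submodule N \<and> S \<subseteq> N \<longrightarrow> N = UNIV)"
  then obtain S where S: "finite S" "\<And>N. submodule N \<Longrightarrow> S \<subseteq> N \<Longrightarrow> N = UNIV" by blast
  note A = integro_diff_algebra_gen
  have zero: "(\<lambda>p. 0) \<in> integro_diff_algebra" by (rule D_algebra_subset[OF zero_in_D_algebra])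
  \<comment> \<open>The zero operator is written as id - id.\<close>
  have act_zero: "act (\<lambda>p. 0) v = 0" for v
    using act_diff_left(2)[OF A(6) A(6), of v] by simp
  define N where "N = {v. \<exists>a. (\<forall>s\<in>S. a s \<in> integro_diff_algebra) \<and> v = (\<Sum>s\<in>S. act (a s) s)}"
  have actN: "act b v \<in> N" if b: "b \<in> integro_diff_algebra" and "v \<in> N" for b v
  proof -
    obtain a where a: "\<forall>s\<in>S. a s \<in> integro_diff_algebra" "v = (\<Sum>s\<in>S. act (a s) s)"
      using \<open>v \<in> N\<close> unfolding N_def by blast
    have "act b v = (\<Sum>s\<in>S. act b (act (a s) s))"
      unfolding a(2) by (rule module_hom.sum[OF Vector_Spaces.linear.axioms(3)[OF act_linear[OF b]]])
    also have "\<dots> = (\<Sum>s\<in>S. act (b \<circ> a s) s)"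
      by (rule sum.cong) (use a(1) b act_comp in auto)
    finally have "act b v = (\<Sum>s\<in>S. act (b \<circ> a s) s)" .
    moreover have "\<forall>s\<in>S. b \<circ> a s \<in> integro_diff_algebra" using a(1) b integro_diff_algebra_closed(1) by blast
    ultimately show ?thesis unfolding N_def mem_Collect_eq by (intro exI[of _ "\<lambda>s. b \<circ> a s"] conjI)
  qed
  have "submodule N"
    unfolding submodule_def
  proof (intro conjI ballI subspaceI)
    show "0 \<in> N" unfolding N_def mem_Collect_eq
      by (rule exI[of _ "\<lambda>s p. 0"]) (simp add: zero act_zero)
    show "v + w \<in> N" if "v \<in> N" "w \<in> N" for v w
    proof -
      obtain a where a: "\<forall>s\<in>S. a s \<in> integro_diff_algebra" "v = (\<Sum>s\<in>S. act (a s) s)"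
        using \<open>v \<in> N\<close> unfolding N_def by blast
      obtain b where b: "\<forall>s\<in>S. b s \<in> integro_diff_algebra" "w = (\<Sum>s\<in>S. act (b s) s)"
        using \<open>w \<in> N\<close> unfolding N_def by blast
      have "v + w = (\<Sum>s\<in>S. act (\<lambda>p. a s p + b s p) s)"
        unfolding a(2) b(2) sum.distrib[symmetric] by (rule sum.cong) (use a(1) b(1) act_add_left in auto)
      moreover have "\<forall>s\<in>S. (\<lambda>p. a s p + b s p) \<in> integro_diff_algebra"
        using a(1) b(1) integro_diff_algebra_closed(2) by blast
      ultimately show ?thesis unfolding N_def mem_Collect_eq by (intro exI[of _ "\<lambda>s p. a s p + b s p"] conjI)
    qed
    show "scl c v \<in> N" if "v \<in> N" for c v
      unfolding module_scale_def by (rule actN[OF A(5) that])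
  qed (rule actN)
  moreover have "S \<subseteq> N"
  proof
    fix s assume s: "s \<in> S"
    \<comment> \<open>A generator s has coefficient id at s and 0 elsewhere.\<close>
    have "(\<Sum>t\<in>S. act (if t = s then id else (\<lambda>p. 0)) t) = (\<Sum>t\<in>S. if t = s then t else 0)"
      by (rule sum.cong) (simp_all add: act_id act_zero)
    then have "s = (\<Sum>t\<in>S. act (if t = s then id else (\<lambda>p. 0)) t)" using S(1) s by simp
    then show "s \<in> N" unfolding N_def mem_Collect_eq
      by (intro exI[of _ "\<lambda>t. if t = s then id else (\<lambda>p. 0)"] conjI) (simp_all add: A zero)
  qed
  ultimately have "N = UNIV" by (rule S(2))
  then show "finitely_generated integro_diff_algebra act"
    unfolding finitely_generated_def using S(1) N_def by blast
qed

end

theorem corollary3p9: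
  fixes act :: "('k::field_char_0, 'n::finite) mpoly_op \<Rightarrow> 'm::ab_group_add \<Rightarrow> 'm"
  assumes "gen_weight_module act"
  shows "finitely_generated integro_diff_algebra act \<longleftrightarrow>
    (\<exists>Orbs. finite Orbs \<and> Orbs \<subseteq> range translation_orbit \<and> supp act \<subseteq> \<Union>Orbs) \<and>
    (\<exists>d. \<forall>\<mu>. dim_at_most (module_scale act) (gen_weight_component act \<mu>) d)"
proof -
  have module: "left_module integro_diff_algebra act"
    and decomposition: "direct_sum_decomposition (gen_weight_component act)"
    using assms unfolding gen_weight_module_def by (rule conjunct1, rule conjunct2)
  interpret integro_diff_module act
    by (rule integro_diff_module.intro) (rule module)
  interpret weight_decomposition scl "\<lambda>i. act (integration i)" "\<lambda>i. act (partial i)"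
    "\<lambda>i. act (H_op i)" "gen_weight_component act"
    by (rule weight_decomposition) (rule decomposition)
  \<comment> \<open>This links the two descriptions of finite generation, by submodules and by
    \<open>stable\<close> subspaces.\<close>
  have "submodule N \<longleftrightarrow> stable N" for N
  proof
    show "submodule N \<Longrightarrow> stable N"
      unfolding submodule_def stable_def by (simp add: integro_diff_algebra_gen)
    show "stable N \<Longrightarrow> submodule N"
      unfolding stable_def by (rule submoduleI) simp_all
  qed
  then show ?thesis
    unfolding finitely_generated_iff supp_def using generated_iff by (simp only:)
qed

end
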